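(* There exist absolute constants $C>0$ and $\delta_0>0$ such that the following holds for all integers $s\ge 3$ and $k\ge 1$ and all real $\delta\le\delta_0$: if $\mathcal{F}\subseteq \binom{[sk]}{k}$ is a family with $\nu(\mathcal{F})\le s-1$ and minimum degree at least $\delta\binom{sk-1}{k-1}$, then $$|\mathcal{F}|\le \Bigl(\frac{s-1}{s}-\frac{(s-2)\delta}{s^3(s-1)C}\Bigr)\binom{sk}{k}.$$
   Context: Let $[n]=\{1,\dots,n\}$ and let $\binom{[n]}{k}$ denote the family of all $k$-element subsets of $[n]$. The matching number $\nu(\mathcal{F})$ of a family $\mathcal{F}$ of sets is the maximum number of pairwise disjoint members of $\mathcal{F}$. For $\mathcal{F}\subseteq\binom{[n]}{k}$, the degree of $x\in[n]$ is $|\{F\in\mathcal{F}: x\in F\}|$, and the minimum degree of $\mathcal{F}$ is the minimum of the degrees over all $x\in[n]$ (here $n=sk$). *)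

theory Defs
  imports Complex_Main "HOL-Library.Disjoint_Sets" "HOL-Library.Ramsey"
begin

(* The maxima and minima below are taken with Max and Min, so matching_number is meaningful
   for finite families only, and min_degree for a finite nonempty ground set. *)

definition matching_number :: "'a set set \<Rightarrow> nat" where
  "matching_number \<F> = Max {card M | M. M \<subseteq> \<F> \<and> disjoint M}"

definition family_degree :: "'a set set \<Rightarrow> 'a \<Rightarrow> nat" where
  "family_degree \<F> x = card {F \<in> \<F>. x \<in> F}"

definition min_degree :: "'a set \<Rightarrow> 'a set set \<Rightarrow> nat" where
  "min_degree X \<F> = Min (family_degree \<F> ` X)"

end

theory Submission
  imports Defs "HOL-Analysis.Convex" "HOL-Combinatorics.Permutations"
begin

text \<open>
Let \<open>G\<close> be the family of those \<open>k\<close>-sets that are not in \<open>\<F>\<close>, and \<open>\<alpha>\<close> its density.  As \<open>\<F>\<close> has no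
\<open>s\<close> pairwise disjoint members, every partition of the \<open>s * k\<close> points into \<open>k\<close>-sets contains a member
of \<open>G\<close>.  A random partition contains \<open>s * \<alpha>\<close> of them on average, so the expected surplus
\<open>\<tau> = s * \<alpha> - 1\<close> is nonnegative; this is Kleitman's bound.  The theorem asks for more: \<open>s\<^sup>2 * \<tau>\<close> has to
be at least a constant multiple of the minimum degree fraction \<open>\<delta>\<close>.  The extremal \<open>G\<close> are the stars,
and the theorem follows from a stability statement: if \<open>s\<^sup>2 * \<tau>\<close> is small, then \<open>G\<close> contains all but a
fraction \<open>100 * s\<^sup>2 * \<tau>\<close> of the star of some point \<open>x\<close>.  The rest of that star, at least a fraction
\<open>\<delta>\<close>, is the degree of \<open>x\<close> in \<open>\<F>\<close>.

The stability statement has three ingredients.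

Spectral gap.  A small surplus means that two random disjoint sets are rarely both in \<open>G\<close>, although
its density is at least \<open>1 / s\<close>, the maximum for intersecting families.  So \<open>G\<close> is nearly extremal for the
ratio bound of the Kneser graph, and its indicator function is close in mean square to a linear
function \<open>A \<mapsto> (\<Sum>y\<in>A. c y)\<close> (\<open>residual_small\<close>).  The necessary eigenvalue estimate
(\<open>kneser_form_star_free\<close>) avoids representation theory: differences under swapping two elements
commute with the Kneser operator up to a small factor (\<open>disj_avg_swap\<close>), and log-convexity of the
norms of iterates (\<open>norm_le_of_iterates_bounded\<close>) makes a mean-square bound of this contraction.

Boolean linear functions depend on one coordinate.  Two random blocks with randomly exchanged
elements turn the linear function into a Rademacher sum which, up to a small error, has constant
modulus 0 or 1.  Such a sum is dominated by a single weight (\<open>rademacher_dominant_weight\<close>).  As the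
modulus is often 1, some difference \<open>c a - c b\<close> is close to 1, and this forces a point of degree
fraction above \<open>0.63\<close> (\<open>ex_large_degree\<close>).  The error in this step is of the order of the square root
of the surplus.

Bootstrapping.  The star of that point \<open>x\<close> is even nearly full, with an error linear in the surplus
(\<open>large_degree_nearly_full\<close>): the members of \<open>G\<close> that avoid \<open>x\<close> must make up for the sets missing
from the star, but they are rarely disjoint from the many members through \<open>x\<close>, which by expansion
allows only few of them.
\<close>

section \<open>Averages over finite sets\<close>

definition avg :: "'a set \<Rightarrow> ('a \<Rightarrow> real) \<Rightarrow> real" where
  "avg \<Omega> f = (\<Sum>x\<in>\<Omega>. f x) / card \<Omega>"

lemma avg_cong: "(\<And>x. x \<in> \<Omega> \<Longrightarrow> f x = g x) \<Longrightarrow> avg \<Omega> f = avg \<Omega> g"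
  by (simp add: avg_def)

lemma avg_add: "avg \<Omega> (\<lambda>x. f x + g x) = avg \<Omega> f + avg \<Omega> g"
  by (simp add: avg_def sum.distrib add_divide_distrib)

lemma avg_diff: "avg \<Omega> (\<lambda>x. f x - g x) = avg \<Omega> f - avg \<Omega> g"
  by (simp add: avg_def sum_subtractf diff_divide_distrib)

lemma avg_cmult: "avg \<Omega> (\<lambda>x. c * f x) = c * avg \<Omega> f"
  by (simp add: avg_def sum_distrib_left)

lemma avg_divide: "avg \<Omega> (\<lambda>x. f x / c) = avg \<Omega> f / c"
  by (simp add: avg_def sum_divide_distrib mult.commute)

lemma avg_const: "finite \<Omega> \<Longrightarrow> \<Omega> \<noteq> {} \<Longrightarrow> avg \<Omega> (\<lambda>x. c) = c"
  by (simp add: avg_def)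

lemma avg_mono: "(\<And>x. x \<in> \<Omega> \<Longrightarrow> f x \<le> g x) \<Longrightarrow> avg \<Omega> f \<le> avg \<Omega> g"
  by (simp add: avg_def sum_mono divide_right_mono)

lemma avg_nonneg: "(\<And>x. x \<in> \<Omega> \<Longrightarrow> 0 \<le> f x) \<Longrightarrow> 0 \<le> avg \<Omega> f"
  by (simp add: avg_def sum_nonneg)

lemma avg_swap: "avg A (\<lambda>x. avg B (\<lambda>y. f x y)) = avg B (\<lambda>y. avg A (\<lambda>x. f x y))"
  unfolding avg_def by (simp add: sum_divide_distrib[symmetric] sum.swap[of _ A] mult.commute)

lemma abs_avg_le:
  assumes "\<And>x. x \<in> \<Omega> \<Longrightarrow> \<bar>f x\<bar> \<le> c" and "0 \<le> c"
  shows "\<bar>avg \<Omega> f\<bar> \<le> c"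
proof (cases "card \<Omega> = 0")
  case False
  have "\<bar>\<Sum>x\<in>\<Omega>. f x\<bar> \<le> (\<Sum>x\<in>\<Omega>. c)"
    using assms by (intro order_trans[OF sum_abs] sum_mono) auto
  then show ?thesis
    using False by (simp add: avg_def abs_divide field_simps)
qed (use assms in \<open>simp add: avg_def\<close>)

lemma avg_Cauchy_Schwarz: "(avg \<Omega> (\<lambda>x. f x * g x))\<^sup>2 \<le> avg \<Omega> (\<lambda>x. (f x)\<^sup>2) * avg \<Omega> (\<lambda>x. (g x)\<^sup>2)"
  using Cauchy_Schwarz_ineq_sum[of f g \<Omega>]
  by (simp add: avg_def power_divide divide_right_mono flip: power2_eq_square)

section \<open>Averaging over disjoint sets\<close>

lemma sum_nsets_Suc:
  assumes "finite X" "x \<in> X"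
  shows "(\<Sum>A\<in>nsets X (Suc j). f A) =
    (\<Sum>A\<in>nsets (X - {x}) (Suc j). f A) + (\<Sum>S\<in>nsets (X - {x}) j. f (insert x S))"
proof -
  have eq: "nsets X (Suc j) = nsets (X - {x}) (Suc j) \<union> insert x ` nsets (X - {x}) j"
  proof (intro set_eqI iffI)
    fix A assume A: "A \<in> nsets X (Suc j)"
    show "A \<in> nsets (X - {x}) (Suc j) \<union> insert x ` nsets (X - {x}) j"
    proof (cases "x \<in> A")
      case True
      then have "A = insert x (A - {x})" "A - {x} \<in> nsets (X - {x}) j"
        using A by (auto simp: nsets_def)
      then show ?thesis by blast
    qed (use A in \<open>auto simp: nsets_def\<close>)
  qed (use assms in \<open>auto simp: nsets_def card_insert_if\<close>)
  have inj: "inj_on (insert x) (nsets (X - {x}) j)"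
    unfolding inj_on_def nsets_def by blast
  show ?thesis
    unfolding eq
    by (subst sum.union_disjoint)
       (use assms in \<open>auto simp: finite_imp_finite_nsets sum.reindex[OF inj]\<close>, auto simp: nsets_def)
qed

lemma sum_nsets_containing:
  assumes "finite X" "x \<in> X"
  shows "(\<Sum>A\<in>nsets X (Suc j). if x \<in> A then f A else 0) = (\<Sum>S\<in>nsets (X - {x}) j. f (insert x S))"
proof -
  have "(\<Sum>A\<in>nsets (X - {x}) (Suc j). if x \<in> A then f A else 0) = 0"
    by (intro sum.neutral) (auto simp: nsets_def)
  then show ?thesis by (simp add: sum_nsets_Suc[OF assms])
qed

text \<open>
The (bipartite) Kneser operator: its value at \<open>B\<close> is the mean of \<open>f\<close> over the \<open>j\<close>-sets
disjoint from \<open>B\<close>.  Only arguments \<open>B\<close> of one fixed size are of interest at a time, so the size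
of \<open>B\<close> is not a parameter.
\<close>

definition disj_avg :: "'a set \<Rightarrow> nat \<Rightarrow> ('a set \<Rightarrow> real) \<Rightarrow> 'a set \<Rightarrow> real" where
  "disj_avg X j f B = avg (nsets (X - B) j) f"

lemma disj_avg_cong: "(\<And>S. S \<in> nsets X j \<Longrightarrow> f S = g S) \<Longrightarrow> disj_avg X j f B = disj_avg X j g B"
  unfolding disj_avg_def by (intro avg_cong) (auto simp: nsets_def)

text \<open>
The source of all spectral information.  A set disjoint from \<open>insert a U\<close> is distinguished from
one disjoint from \<open>insert b U\<close> only by containing \<open>b\<close> or \<open>a\<close>; all other sets cancel.  So taking a
swap difference commutes with the Kneser operator up to a negative factor, while the sets become
smaller and the ground set loses \<open>a\<close> and \<open>b\<close>.  Division by zero makes the identity true also when no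
\<open>j\<close>-set is disjoint from \<open>insert a U\<close>.
\<close>

lemma disj_avg_swap:
  assumes X: "finite X" and ab: "a \<in> X - U" "b \<in> X - U" "a \<noteq> b" and U: "U \<subseteq> X"
  shows "disj_avg X j f (insert a U) - disj_avg X j f (insert b U) =
    - (real j / (real (card X) - real (card U) - 1)) *
      disj_avg (X - {a, b}) (j - 1) (\<lambda>S. f (insert a S) - f (insert b S)) U"
proof (cases j)
  case 0
  then show ?thesis by (simp add: disj_avg_def avg_def)
next
  case (Suc i)
  define Y where "Y = X - insert a (insert b U)"
  define m where "m = card Y"
  have finY: "finite Y" using X by (simp add: Y_def)
  have ca: "card (X - insert a U) = Suc m" and cb: "card (X - insert b U) = Suc m"
  proof -
    have "X - insert a U = insert b Y" "X - insert b U = insert a Y" "a \<notin> Y" "b \<notin> Y"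
      using ab by (auto simp: Y_def)
    then show "card (X - insert a U) = Suc m" "card (X - insert b U) = Suc m"
      using finY by (simp_all add: m_def)
  qed
  have cX: "real (card X) - real (card U) - 1 = real (Suc m)"
  proof -
    have "finite U" using X U finite_subset by blast
    then have "card (X - insert a U) = card X - Suc (card U)"
      using ab U by (subst card_Diff_subset) auto
    moreover have "Suc (card U) \<le> card X"
      using \<open>finite U\<close> ab U X by (metis DiffE card_insert_disjoint card_mono insert_subset)
    ultimately show ?thesis using ca by linarith
  qed
  have Sa: "(\<Sum>S\<in>nsets (X - insert a U) (Suc i). f S) =
      (\<Sum>S\<in>nsets Y (Suc i). f S) + (\<Sum>S\<in>nsets Y i. f (insert b S))"
    using sum_nsets_Suc[of "X - insert a U" b f i] ab X
    by (simp add: Y_def) (metis Diff_insert insert_commute)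
  have Sb: "(\<Sum>S\<in>nsets (X - insert b U) (Suc i). f S) =
      (\<Sum>S\<in>nsets Y (Suc i). f S) + (\<Sum>S\<in>nsets Y i. f (insert a S))"
    using sum_nsets_Suc[of "X - insert b U" a f i] ab X
    by (simp add: Y_def) (metis Diff_insert insert_commute)
  have Y': "X - {a, b} - U = Y" by (auto simp: Y_def)
  have bin: "real (Suc i) * real (Suc m choose Suc i) = real (Suc m) * real (m choose i)"
    using Suc_times_binomial[of i m] by (metis of_nat_mult)
  show ?thesis
  proof (cases "m choose i = 0")
    case True
    then have True': "Suc m choose Suc i = 0" by (simp add: binomial_eq_0_iff)
    with True show ?thesis
      using X finY ca cb
      by (simp add: Suc disj_avg_def avg_def Y' True' del: binomial_Suc_Suc flip: m_def)
  next
    case False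
    then have nz: "real (m choose i) \<noteq> 0" "real (Suc m choose Suc i) \<noteq> 0"
      by (simp_all add: binomial_eq_0_iff del: binomial_Suc_Suc)
    have "1 / real (Suc m choose Suc i) = real (Suc i) / (real (Suc m) * real (m choose i))"
      using bin nz by (subst frac_eq_eq) (auto simp del: of_nat_Suc binomial_Suc_Suc)
    then have e: "x / real (Suc m choose Suc i) = x * (real (Suc i) / (real (Suc m) * real (m choose i)))" for x
      by (metis mult.right_neutral times_divide_eq_right)
    show ?thesis
      unfolding disj_avg_def avg_def Suc cX Y' Sa Sb
      using X finY ca cb
      by (simp add: card_nsets e sum_subtractf Sa Sb flip: m_def del: binomial_Suc_Suc of_nat_Suc)
         (simp add: algebra_simps minus_divide_left del: of_nat_Suc flip: add_divide_distrib diff_divide_distrib)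
  qed
qed

lemma sum_nsets_disjoint_swap:
  assumes "finite X"
  shows "(\<Sum>B\<in>nsets X k. \<Sum>S\<in>nsets (X - B) j. F B S) = (\<Sum>S\<in>nsets X j. \<Sum>B\<in>nsets (X - S) k. F B S)"
proof -
  have eq: "nsets (X - B) j = {S \<in> nsets X j. S \<inter> B = {}}" for B j
    by (auto simp: nsets_def)
  have "(\<Sum>B\<in>nsets X k. \<Sum>S\<in>nsets (X - B) j. F B S) =
      (\<Sum>B\<in>nsets X k. \<Sum>S\<in>nsets X j. if S \<inter> B = {} then F B S else 0)"
    unfolding eq using assms by (simp add: sum.inter_filter finite_imp_finite_nsets)
  also have "\<dots> = (\<Sum>S\<in>nsets X j. \<Sum>B\<in>nsets X k. if B \<inter> S = {} then F B S else 0)"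
    by (subst sum.swap) (simp add: Int_commute)
  also have "\<dots> = (\<Sum>S\<in>nsets X j. \<Sum>B\<in>nsets (X - S) k. F B S)"
    unfolding eq using assms by (simp add: sum.inter_filter finite_imp_finite_nsets)
  finally show ?thesis .
qed

lemma card_nsets_Diff:
  assumes "finite X" "B \<in> nsets X k"
  shows "card (nsets (X - B) j) = (card X - k) choose j"
proof -
  have "card (X - B) = card X - k" using assms by (auto simp: nsets_def card_Diff_subset)
  then show ?thesis by simp
qed

text \<open>
Choosing a random \<open>k\<close>-set and then a random \<open>j\<close>-set disjoint from it gives the same distribution
on disjoint pairs as choosing the \<open>j\<close>-set first.
\<close>

lemma disj_avg_adjoint:
  assumes X: "finite X"
  shows "avg (nsets X k) (\<lambda>B. u B * disj_avg X j v B) = avg (nsets X j) (\<lambda>S. disj_avg X k u S * v S)"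
proof -
  let ?n = "card X"
  have cnt: "(?n choose k) * ((?n - k) choose j) = (?n choose j) * ((?n - j) choose k)"
  proof -
    have eq: "(\<Sum>B\<in>nsets X k. \<Sum>S\<in>nsets (X - B) j. 1::nat) = (?n choose k) * ((?n - k) choose j)" for j k
    proof -
      have "(\<Sum>B\<in>nsets X k. \<Sum>S\<in>nsets (X - B) j. 1::nat) = (\<Sum>B\<in>nsets X k. (?n - k) choose j)"
        by (intro sum.cong refl) (simp add: card_nsets_Diff[OF X] del: card_nsets)
      then show ?thesis by simp
    qed
    show ?thesis
      using sum_nsets_disjoint_swap[OF X, of "\<lambda>_ _. 1::nat" j k] by (simp only: eq)
  qed
  have "avg (nsets X k) (\<lambda>B. u B * disj_avg X j v B) =
      (\<Sum>B\<in>nsets X k. \<Sum>S\<in>nsets (X - B) j. u B * v S) / real ((?n choose k) * ((?n - k) choose j))"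
    unfolding avg_def disj_avg_def
    by (simp add: card_nsets[of X] card_nsets_Diff[OF X] del: card_nsets add: sum_distrib_left sum_divide_distrib mult.commute)
  also have "\<dots> = (\<Sum>S\<in>nsets X j. \<Sum>B\<in>nsets (X - S) k. u B * v S) / real ((?n choose j) * ((?n - j) choose k))"
    by (simp only: cnt sum_nsets_disjoint_swap[OF X, of _ j k])
  also have "\<dots> = avg (nsets X j) (\<lambda>S. disj_avg X k u S * v S)"
    unfolding avg_def disj_avg_def
    by (simp add: card_nsets[of X] card_nsets_Diff[OF X] del: card_nsets add: sum_distrib_left sum_distrib_right sum_divide_distrib mult.commute)
  finally show ?thesis .
qed

lemma disj_avg_const:
  assumes "finite X" "B \<in> nsets X k" "j + k \<le> card X"
  shows "disj_avg X j (\<lambda>_. c) B = c"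
proof -
  have "card (nsets (X - B) j) \<noteq> 0" using assms by (subst card_nsets_Diff) auto
  then show ?thesis by (simp add: disj_avg_def avg_def del: card_nsets)
qed

section \<open>Contraction of swap differences\<close>

text \<open>
The condition \<open>Suc (card U) = j\<close> rather than \<open>card U = j - 1\<close> makes the predicate vacuous for
\<open>j = 0\<close>, where there is no swap.
\<close>

definition swap_lipschitz :: "'a set \<Rightarrow> nat \<Rightarrow> real \<Rightarrow> ('a set \<Rightarrow> real) \<Rightarrow> bool" where
  "swap_lipschitz X j \<nu> f \<longleftrightarrow>
    (\<forall>U a b. U \<subseteq> X \<longrightarrow> Suc (card U) = j \<longrightarrow> a \<in> X - U \<longrightarrow> b \<in> X - U \<longrightarrow> a \<noteq> b \<longrightarrow>
      \<bar>f (insert a U) - f (insert b U)\<bar> \<le> \<nu>)"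

lemma swap_lipschitz_disj_avg:
  assumes X: "finite X" and f: "swap_lipschitz X j \<nu> f" and \<nu>: "0 \<le> \<nu>"
  shows "swap_lipschitz X k (real j / (real (card X) - real k) * \<nu>) (disj_avg X j f)"
  unfolding swap_lipschitz_def
proof (intro allI impI)
  fix U a b assume U: "U \<subseteq> X" "Suc (card U) = k" and ab: "a \<in> X - U" "b \<in> X - U" "a \<noteq> b"
  have "finite U" using U X finite_subset by blast
  then have "card (insert a U) = k" using U ab by simp
  then have k: "k \<le> card X" using card_mono[OF X, of "insert a U"] U ab by simp
  have k': "real (card X) - real (card U) - 1 = real (card X) - real k"
    using U by linarith
  have "\<bar>disj_avg (X - {a, b}) (j - 1) (\<lambda>S. f (insert a S) - f (insert b S)) U\<bar> \<le> \<nu>" if "j \<noteq> 0"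
    unfolding disj_avg_def
  proof (rule abs_avg_le[OF _ \<nu>])
    fix S assume "S \<in> nsets (X - {a, b} - U) (j - 1)"
    then have "S \<subseteq> X" "Suc (card S) = j" "a \<in> X - S" "b \<in> X - S"
      using that ab by (auto simp: nsets_def)
    then show "\<bar>f (insert a S) - f (insert b S)\<bar> \<le> \<nu>"
      using f \<open>a \<noteq> b\<close> by (simp add: swap_lipschitz_def)
  qed
  then show "\<bar>disj_avg X j f (insert a U) - disj_avg X j f (insert b U)\<bar> \<le> real j / (real (card X) - real k) * \<nu>"
    unfolding disj_avg_swap[OF X ab U(1)] k' using k
    by (cases "j = 0") (auto simp: abs_mult intro!: divide_right_mono mult_left_mono)
qed

text \<open>
At most \<open>j\<close> swaps lead from one \<open>j\<close>-set to another.
\<close>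

lemma swap_lipschitz_osc:
  assumes X: "finite X" and f: "swap_lipschitz X j \<nu> f"
    and "A \<in> nsets X j" "B \<in> nsets X j" and \<nu>: "0 \<le> \<nu>"
  shows "\<bar>f A - f B\<bar> \<le> real j * \<nu>"
proof -
  have "\<bar>f A - f B\<bar> \<le> real (card (A - B)) * \<nu>" if "A \<in> nsets X j" "B \<in> nsets X j" for A B
    using that
  proof (induction "card (A - B)" arbitrary: A)
    case 0
    then have AB: "A \<subseteq> B" "finite B" "card A = card B" by (auto simp: nsets_def)
    have "A = B" using card_subset_eq[OF AB(2,1,3)] .
    then show ?case by simp
  next
    case (Suc d)
    have fin: "finite A" "finite B" and cAB: "card A = card B" using Suc.prems by (auto simp: nsets_def)
    obtain a where a: "a \<in> A" "a \<notin> B" using Suc.hyps(2) by (metis DiffE card_eq_0_iff ex_in_conv nat.distinct(1))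
    have "\<not> B \<subseteq> A" using a cAB fin card_subset_eq by metis
    then obtain b where b: "b \<in> B" "b \<notin> A" by blast
    define U where "U = A - {a}"
    have jA: "card A = j" "A \<subseteq> X" "B \<subseteq> X" using Suc.prems by (auto simp: nsets_def)
    have U: "insert a U = A" "U \<subseteq> X" using a jA by (auto simp: U_def)
    have cU: "Suc (card U) = j" using card_Suc_Diff1[OF fin(1) a(1)] jA by (simp add: U_def)
    let ?A' = "insert b U"
    have "card ?A' = j" using cU b fin by (simp add: U_def)
    then have A': "?A' \<in> nsets X j" using U b fin jA by (auto simp: nsets_def U_def)
    have "?A' - B = (A - B) - {a}" using a b by (auto simp: U_def)
    then have "card (?A' - B) = d" using Suc.hyps(2) a fin by simp
    then have 1: "\<bar>f ?A' - f B\<bar> \<le> real d * \<nu>" using Suc.hyps(1)[of ?A'] A' Suc.prems by simp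
    have "\<bar>f (insert a U) - f (insert b U)\<bar> \<le> \<nu>"
    proof -
      have "a \<in> X - U" "b \<in> X - U" "a \<noteq> b" using a b jA by (auto simp: U_def)
      then show ?thesis using f U(2) cU unfolding swap_lipschitz_def by blast
    qed
    then show ?case using 1 Suc.hyps(2)[symmetric] U(1) by (simp add: algebra_simps)
  qed
  from this[OF assms(3,4)] have "\<bar>f A - f B\<bar> \<le> real (card (A - B)) * \<nu>" .
  also have "card (A - B) \<le> j" using assms(3) card_mono[of A "A - B"] by (auto simp: nsets_def)
  then have "real (card (A - B)) * \<nu> \<le> real j * \<nu>" using \<nu> by (simp add: mult_right_mono)
  finally show ?thesis .
qed

lemma swap_lipschitz_sup:
  assumes X: "finite X" and f: "swap_lipschitz X j \<nu> f" and \<nu>: "0 \<le> \<nu>"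
    and zero: "(\<Sum>A\<in>nsets X j. f A) = 0" and A: "A \<in> nsets X j"
  shows "\<bar>f A\<bar> \<le> real j * \<nu>"
proof -
  have fin: "finite (nsets X j)" "nsets X j \<noteq> {}" using X A by (auto simp: finite_imp_finite_nsets)
  have "f A = avg (nsets X j) (\<lambda>B. f A - f B)"
    using zero by (simp add: avg_diff avg_const[OF fin]) (simp add: avg_def)
  also have "\<bar>\<dots>\<bar> \<le> real j * \<nu>"
    using swap_lipschitz_osc[OF X f A _ \<nu>] \<nu> by (intro abs_avg_le) auto
  finally show ?thesis .
qed

lemma ex_swap_lipschitz:
  assumes X: "finite X"
  shows "\<exists>\<nu>\<ge>0. swap_lipschitz X j \<nu> f"
proof -
  define \<nu> where "\<nu> = 2 * (\<Sum>A\<in>Pow X. \<bar>f A\<bar>)"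
  have le: "\<bar>f A\<bar> \<le> \<nu> / 2" if "A \<subseteq> X" for A
    unfolding \<nu>_def using that X member_le_sum[of A "Pow X" "\<lambda>A. \<bar>f A\<bar>"] by simp
  have "swap_lipschitz X j \<nu> f"
    unfolding swap_lipschitz_def
  proof (intro allI impI)
    fix U a b assume "U \<subseteq> X" "a \<in> X - U" "b \<in> X - U"
    then show "\<bar>f (insert a U) - f (insert b U)\<bar> \<le> \<nu>"
      using le[of "insert a U"] le[of "insert b U"] by auto
  qed
  moreover have "\<nu> \<ge> 0" by (simp add: \<nu>_def sum_nonneg)
  ultimately show ?thesis by blast
qed

text \<open>
The squared norms \<open>a m\<close> of the iterates of a symmetric operator are log-convex by the
Cauchy-Schwarz inequality, so the first ratio \<open>a 1 / a 0\<close> is at most the exponential growth rate of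
the sequence.  A rough pointwise bound on all iterates, with an arbitrary constant \<open>C\<close>, therefore
already yields the sharp bound on one application.  This replaces a diagonalisation.
\<close>

lemma norm_le_of_iterates_bounded:
  fixes T :: "('a \<Rightarrow> real) \<Rightarrow> 'a \<Rightarrow> real"
  assumes fin: "finite \<Omega>" "\<Omega> \<noteq> {}"
    and sym: "\<And>u v. avg \<Omega> (\<lambda>x. u x * T v x) = avg \<Omega> (\<lambda>x. T u x * v x)"
    and bound: "\<And>m x. x \<in> \<Omega> \<Longrightarrow> \<bar>(T ^^ m) f x\<bar> \<le> C * r ^ m"
    and r: "0 \<le> r"
  shows "avg \<Omega> (\<lambda>x. (T f x)\<^sup>2) \<le> r\<^sup>2 * avg \<Omega> (\<lambda>x. (f x)\<^sup>2)"
proof (rule ccontr)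
  define a where "a m = avg \<Omega> (\<lambda>x. ((T ^^ m) f x)\<^sup>2)" for m
  assume "\<not> ?thesis"
  then have gt: "a 1 > r\<^sup>2 * a 0" by (simp add: a_def)
  have nonneg: "a m \<ge> 0" for m unfolding a_def by (intro avg_nonneg) simp
  have convex: "(a (Suc m))\<^sup>2 \<le> a m * a (Suc (Suc m))" for m
  proof -
    have "a (Suc m) = avg \<Omega> (\<lambda>x. (T ^^ m) f x * (T ^^ Suc (Suc m)) f x)"
      using sym[of "(T ^^ m) f" "(T ^^ Suc m) f"] by (simp add: a_def power2_eq_square)
    then show ?thesis
      unfolding a_def using avg_Cauchy_Schwarz by metis
  qed
  have a1: "a 1 > 0" using gt nonneg[of 0] by (smt (verit) mult_nonneg_nonneg zero_le_power2)
  have a0: "a 0 > 0"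
    using convex[of 0] a1 nonneg[of 0] by (smt (verit) One_nat_def mult_eq_0_iff zero_less_power2)
  define q where "q = a 1 / a 0"
  have q: "q > r\<^sup>2" "q > 0" using gt a0 a1 by (simp_all add: q_def field_simps)
  have step: "a m > 0 \<and> a (Suc m) \<ge> q * a m" for m
  proof (induction m)
    case 0
    then show ?case using a0 by (simp add: q_def)
  next
    case (Suc m)
    then have pos: "a (Suc m) > 0" using q by (smt (verit) mult_pos_pos)
    have "q * a m * a (Suc m) \<le> a (Suc m) * a (Suc m)" using Suc pos by (intro mult_right_mono) auto
    also have "\<dots> \<le> a m * a (Suc (Suc m))" using convex[of m] by (simp add: power2_eq_square)
    finally have "a m * (q * a (Suc m)) \<le> a m * a (Suc (Suc m))" by (simp add: algebra_simps)
    then show ?case using Suc pos by simp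
  qed
  have lower: "a m \<ge> a 0 * q ^ m" for m
  proof (induction m)
    case (Suc m)
    then show ?case using step[of m] q(2) by simp (smt (verit, best) mult.assoc mult.commute mult_left_mono)
  qed simp
  have upper: "a m \<le> C\<^sup>2 * (r\<^sup>2) ^ m" for m
  proof -
    have "((T ^^ m) f x)\<^sup>2 \<le> C\<^sup>2 * (r\<^sup>2) ^ m" if "x \<in> \<Omega>" for x
      using power_mono[OF bound[OF that, of m], of 2]
      by (simp add: power_mult_distrib mult.commute flip: power_mult)
    then have "a m \<le> avg \<Omega> (\<lambda>x. C\<^sup>2 * (r\<^sup>2) ^ m)" unfolding a_def by (rule avg_mono)
    then show ?thesis using avg_const[OF fin] by simp
  qed
  show False
  proof (cases "r = 0")
    case True
    then show False using upper[of 1] a1 by simp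
  next
    case False
    then have r2: "r\<^sup>2 > 0" by simp
    define p where "p = q / r\<^sup>2"
    have "p > 1" using q r2 by (simp add: p_def)
    then obtain m where m: "p ^ m > C\<^sup>2 / a 0" using real_arch_pow by blast
    have "a 0 * q ^ m \<le> C\<^sup>2 * (r\<^sup>2) ^ m" using lower upper order_trans by blast
    then have "a 0 * p ^ m \<le> C\<^sup>2" using r2 by (simp add: p_def power_divide field_simps)
    then show False using m a0 by (simp add: field_simps)
  qed
qed

section \<open>Functions orthogonal to all stars\<close>

text \<open>
Orthogonality to the indicator function of every star, hence to all functions
\<open>A \<mapsto> (\<Sum>x\<in>A. c x)\<close>.
\<close>

definition star_free :: "'a set \<Rightarrow> nat \<Rightarrow> ('a set \<Rightarrow> real) \<Rightarrow> bool" where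
  "star_free X k f \<longleftrightarrow> (\<forall>x\<in>X. (\<Sum>A\<in>nsets X k. if x \<in> A then f A else 0) = 0)"

text \<open>
Double counting of the pairs \<open>x \<in> A\<close>, weighted by \<open>c x * f A\<close>.
\<close>

lemma sum_sum_elements:
  fixes f :: "'a set \<Rightarrow> real"
  assumes X: "finite X"
  shows "(\<Sum>x\<in>X. c x * (\<Sum>A\<in>nsets X k. if x \<in> A then f A else 0)) = (\<Sum>A\<in>nsets X k. (\<Sum>x\<in>A. c x) * f A)"
proof -
  have "(\<Sum>x\<in>X. c x * (\<Sum>A\<in>nsets X k. if x \<in> A then f A else 0)) =
      (\<Sum>A\<in>nsets X k. \<Sum>x\<in>X. if x \<in> A then c x * f A else 0)"
    by (subst sum.swap, intro sum.cong refl, subst sum_distrib_left, intro sum.cong refl) simp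
  also have "\<dots> = (\<Sum>A\<in>nsets X k. (\<Sum>x\<in>A. c x) * f A)"
  proof (rule sum.cong[OF refl])
    fix A assume "A \<in> nsets X k"
    then have "X \<inter> A = A" by (auto simp: nsets_def)
    then show "(\<Sum>x\<in>X. if x \<in> A then c x * f A else 0) = (\<Sum>x\<in>A. c x) * f A"
      using X by (simp add: sum_distrib_right sum.inter_restrict[symmetric])
  qed
  finally show ?thesis .
qed

lemma avg_nsets_sum_elements:
  fixes c :: "'a \<Rightarrow> real"
  assumes Y: "finite Y" and j: "j \<le> card Y"
  shows "avg (nsets Y j) (\<lambda>S. \<Sum>y\<in>S. c y) = real j / real (card Y) * (\<Sum>y\<in>Y. c y)"
proof (cases j)
  case 0
  then show ?thesis by (simp add: avg_def)
next
  case (Suc i)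
  have "(\<Sum>S\<in>nsets Y j. \<Sum>y\<in>S. c y) = (\<Sum>y\<in>Y. c y * (\<Sum>S\<in>nsets Y (Suc i). if y \<in> S then 1 else 0))"
    using sum_sum_elements[OF Y, where c = c and k = j and f = "\<lambda>_. 1"] by (simp add: Suc)
  also have "\<dots> = (\<Sum>y\<in>Y. c y * real ((card Y - 1) choose i))"
    using Y by (intro sum.cong refl) (simp add: sum_nsets_containing)
  finally have *: "(\<Sum>S\<in>nsets Y j. \<Sum>y\<in>S. c y) = (\<Sum>y\<in>Y. c y) * real ((card Y - 1) choose i)"
    by (simp add: sum_distrib_right)
  obtain m where m: "card Y = Suc m" using j Suc by (cases "card Y") auto
  have "real (Suc i) * real (Suc m choose Suc i) = real (Suc m) * real (m choose i)"
    using Suc_times_binomial[of i m] by (metis of_nat_mult)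
  moreover have "real (Suc m choose Suc i) \<noteq> 0" using j by (simp add: m Suc del: binomial_Suc_Suc)
  ultimately have "real (m choose i) / real (Suc m choose Suc i) = real (Suc i) / real (Suc m)"
    by (subst frac_eq_eq) (auto simp: mult.commute simp del: binomial_Suc_Suc of_nat_Suc)
  then show ?thesis unfolding avg_def *[unfolded Suc m] card_nsets m Suc
    by (simp del: binomial_Suc_Suc of_nat_Suc) (simp only: times_divide_eq_right[symmetric] mult.commute)
qed

lemma star_free_orthogonal_linear:
  assumes "finite X" "star_free X k f"
  shows "(\<Sum>A\<in>nsets X k. (\<Sum>x\<in>A. c x) * f A) = 0"
  using assms by (simp add: star_free_def flip: sum_sum_elements)

lemma star_free_sum:
  assumes "finite X" "star_free X k f" "k \<noteq> 0"
  shows "(\<Sum>A\<in>nsets X k. f A) = 0"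
proof -
  have "(\<Sum>A\<in>nsets X k. (\<Sum>x\<in>A. 1) * f A) = real k * (\<Sum>A\<in>nsets X k. f A)"
    unfolding sum_distrib_left by (rule sum.cong) (auto simp: nsets_def)
  then show ?thesis using star_free_orthogonal_linear[OF assms(1,2), of "\<lambda>_. 1"] assms(3) by simp
qed

text \<open>
The operator is symmetric and sends the indicator of the star of \<open>x\<close> to a multiple of the indicator
of its complement, which is again in the span of the stars.
\<close>

lemma star_free_disj_avg:
  assumes X: "finite X" and f: "star_free X k f" and k: "k \<noteq> 0"
  shows "star_free X k (disj_avg X k f)"
  unfolding star_free_def
proof
  fix x assume x: "x \<in> X"
  define u where "u A = (if x \<in> A then 1 else 0 :: real)" for A :: "'a set"
  obtain \<kappa> where \<kappa>: "\<And>A. A \<in> nsets X k \<Longrightarrow> disj_avg X k u A = \<kappa> - \<kappa> * u A"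
  proof
    fix A assume A: "A \<in> nsets X k"
    obtain i where i: "k = Suc i" using k not0_implies_Suc by blast
    define \<kappa> where "\<kappa> = real ((card X - k - 1) choose (k - 1)) / real ((card X - k) choose k)"
    show "disj_avg X k u A = \<kappa> - \<kappa> * u A"
    proof (cases "x \<in> A")
      case True
      then have "disj_avg X k u A = avg (nsets (X - A) k) (\<lambda>_. 0)"
        unfolding disj_avg_def by (intro avg_cong) (auto simp: u_def nsets_def)
      then show ?thesis using True by (simp add: avg_def u_def)
    next
      case False
      have "(\<Sum>B\<in>nsets (X - A) (Suc i). u B) = (\<Sum>S\<in>nsets (X - A - {x}) i. 1)"
        unfolding u_def using False x X by (subst sum_nsets_containing) auto
      also have "\<dots> = real ((card X - k - 1) choose i)"
      proof -
        have "card (X - A - {x}) = card X - k - 1"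
          using False x X A by (auto simp: card_Diff_subset nsets_def)
        then show ?thesis by simp
      qed
      finally have "disj_avg X k u A = \<kappa>"
        unfolding disj_avg_def avg_def i[symmetric] \<kappa>_def card_nsets_Diff[OF X A] by (simp add: i)
      then show ?thesis using False by (simp add: u_def)
    qed
  qed
  have "avg (nsets X k) (\<lambda>A. u A * disj_avg X k f A) = avg (nsets X k) (\<lambda>A. disj_avg X k u A * f A)"
    by (rule disj_avg_adjoint[OF X])
  also have "\<dots> = avg (nsets X k) (\<lambda>A. \<kappa> * f A - \<kappa> * (u A * f A))"
    by (intro avg_cong) (simp add: \<kappa> algebra_simps)
  also have "\<dots> = \<kappa> * avg (nsets X k) f - \<kappa> * avg (nsets X k) (\<lambda>A. u A * f A)"
    by (simp only: avg_diff avg_cmult)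
  also have "\<dots> = 0"
    using star_free_sum[OF X f k] f x
    by (simp add: avg_def u_def star_free_def if_distrib[of "\<lambda>z. z * _"] cong: if_cong)
  finally have "avg (nsets X k) (\<lambda>A. u A * disj_avg X k f A) = 0" .
  then have "(\<Sum>A\<in>nsets X k. u A * disj_avg X k f A) = 0 \<or> nsets X k = {}"
    using X finite_imp_finite_nsets[OF X, of k] by (simp add: avg_def del: card_nsets)
  then show "(\<Sum>A\<in>nsets X k. if x \<in> A then disj_avg X k f A else 0) = 0"
    by (auto simp: u_def if_distrib[of "\<lambda>z. z * _"] cong: if_cong)
qed

text \<open>
The sets containing both \<open>a\<close> and \<open>b\<close> contribute equally to the stars of \<open>a\<close> and \<open>b\<close>.  The vanishing
mean allows to recover bounds on \<open>f\<close> from bounds on its second swap differences.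
\<close>

lemma star_free_swap_sum:
  assumes X: "finite X" and f: "star_free X (Suc i) f" and ab: "a \<in> X" "b \<in> X" "a \<noteq> b"
  shows "(\<Sum>S\<in>nsets (X - {a, b}) i. f (insert a S) - f (insert b S)) = 0"
proof -
  have a: "(\<Sum>S\<in>nsets (X - {a}) i. f (insert a S)) = 0"
    and b: "(\<Sum>S\<in>nsets (X - {b}) i. f (insert b S)) = 0"
    using f ab sum_nsets_containing[OF X ab(1), of f i] sum_nsets_containing[OF X ab(2), of f i]
    by (simp_all add: star_free_def)
  have eq: "X - {a} - {b} = X - {a, b}" "X - {b} - {a} = X - {a, b}" by auto
  show ?thesis
  proof (cases i)
    case 0
    then show ?thesis using a b by simp
  next
    case (Suc l)
    have "(\<Sum>S\<in>nsets (X - {a, b}) i. f (insert a S)) + (\<Sum>S\<in>nsets (X - {a, b}) l. f (insert a (insert b S))) = 0"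
      using a sum_nsets_Suc[of "X - {a}" b "\<lambda>S. f (insert a S)" l] X ab by (simp add: Suc eq)
    moreover have "(\<Sum>S\<in>nsets (X - {a, b}) i. f (insert b S)) + (\<Sum>S\<in>nsets (X - {a, b}) l. f (insert b (insert a S))) = 0"
      using b sum_nsets_Suc[of "X - {b}" a "\<lambda>S. f (insert b S)" l] X ab by (simp add: Suc eq)
    ultimately show ?thesis by (simp add: sum_subtractf insert_commute)
  qed
qed

definition swap_lipschitz2 :: "'a set \<Rightarrow> nat \<Rightarrow> real \<Rightarrow> ('a set \<Rightarrow> real) \<Rightarrow> bool" where
  "swap_lipschitz2 X k \<nu> f \<longleftrightarrow> (\<forall>a\<in>X. \<forall>b\<in>X. a \<noteq> b \<longrightarrow>
    swap_lipschitz (X - {a, b}) (k - 1) \<nu> (\<lambda>S. f (insert a S) - f (insert b S)))"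

lemma swap_lipschitz_cmult:
  "swap_lipschitz X j \<nu> f \<Longrightarrow> swap_lipschitz X j (\<bar>c\<bar> * \<nu>) (\<lambda>S. c * f S)"
  unfolding swap_lipschitz_def by (simp add: abs_mult mult_left_mono flip: right_diff_distrib)

lemma swap_lipschitz_mono:
  assumes "swap_lipschitz X j \<nu> f" "\<nu> \<le> \<nu>'"
  shows "swap_lipschitz X j \<nu>' f"
  unfolding swap_lipschitz_def
proof (intro allI impI)
  fix U a b assume "U \<subseteq> X" "Suc (card U) = j" "a \<in> X - U" "b \<in> X - U" "a \<noteq> b"
  then have "\<bar>f (insert a U) - f (insert b U)\<bar> \<le> \<nu>"
    using assms(1) unfolding swap_lipschitz_def by blast
  then show "\<bar>f (insert a U) - f (insert b U)\<bar> \<le> \<nu>'" using assms(2) by linarith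
qed

lemma swap_lipschitz_cong:
  assumes "finite X" "\<And>S. S \<in> nsets X j \<Longrightarrow> f S = g S"
  shows "swap_lipschitz X j \<nu> f \<longleftrightarrow> swap_lipschitz X j \<nu> g"
proof -
  have "f (insert a U) = g (insert a U)" if "U \<subseteq> X" "Suc (card U) = j" "a \<in> X - U" for U a
  proof -
    have "finite U" using that assms finite_subset by blast
    then show ?thesis using that by (intro assms(2)) (auto simp: nsets_def)
  qed
  then show ?thesis unfolding swap_lipschitz_def by (simp cong: imp_cong)
qed

lemma ex_swap_lipschitz2:
  assumes X: "finite X"
  shows "\<exists>\<nu>\<ge>0. swap_lipschitz2 X k \<nu> f"
proof -
  define \<nu> where "\<nu> a b =
    (SOME \<nu>. \<nu> \<ge> 0 \<and> swap_lipschitz (X - {a, b}) (k - 1) \<nu> (\<lambda>S. f (insert a S) - f (insert b S)))" for a b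
  have \<nu>: "\<nu> a b \<ge> 0" "swap_lipschitz (X - {a, b}) (k - 1) (\<nu> a b) (\<lambda>S. f (insert a S) - f (insert b S))" for a b
    using someI_ex[OF ex_swap_lipschitz[of "X - {a, b}" "k - 1" "\<lambda>S. f (insert a S) - f (insert b S)"]] X
    by (simp_all add: \<nu>_def)
  define M where "M = (\<Sum>a\<in>X. \<Sum>b\<in>X. \<nu> a b)"
  have "\<nu> a b \<le> M" if "a \<in> X" "b \<in> X" for a b
  proof -
    have "\<nu> a b \<le> (\<Sum>b\<in>X. \<nu> a b)" using \<nu>(1) X that by (intro member_le_sum) auto
    also have "\<dots> \<le> M" unfolding M_def using \<nu>(1) X that by (intro member_le_sum) (auto intro: sum_nonneg)
    finally show ?thesis .
  qed
  then have "swap_lipschitz2 X k M f"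
    unfolding swap_lipschitz2_def using swap_lipschitz_mono[OF \<nu>(2)] by blast
  moreover have "M \<ge> 0" unfolding M_def using \<nu>(1) by (intro sum_nonneg) auto
  ultimately show ?thesis by blast
qed

lemma swap_lipschitz2_disj_avg:
  assumes X: "finite X" and f: "swap_lipschitz2 X k \<nu> f" and \<nu>: "0 \<le> \<nu>"
    and k: "k + 1 < card X" "k \<noteq> 0"
  shows "swap_lipschitz2 X k
    (real k * (real k - 1) / ((real (card X) - real k) * (real (card X) - real k - 1)) * \<nu>) (disj_avg X k f)"
  unfolding swap_lipschitz2_def
proof (intro ballI impI)
  fix a b assume ab: "a \<in> X" "b \<in> X" "a \<noteq> b"
  let ?Y = "X - {a, b}" and ?D = "\<lambda>f S. f (insert a S) - f (insert b S)"
  let ?c = "real k / (real (card X) - real k)"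
  have cY: "real (card ?Y) - real (k - 1) = real (card X) - real k - 1"
    using ab X k by (simp add: card_Diff_subset)
  have "swap_lipschitz ?Y (k - 1) (real (k - 1) / (real (card X) - real k - 1) * \<nu>)
      (disj_avg ?Y (k - 1) (?D f))"
    using swap_lipschitz_disj_avg[of ?Y "k - 1" \<nu> "?D f" "k - 1"] f ab \<nu> X
    unfolding cY swap_lipschitz2_def by simp
  from swap_lipschitz_cmult[OF this, of "- ?c"]
  have *: "swap_lipschitz ?Y (k - 1) (?c * (real (k - 1) / (real (card X) - real k - 1) * \<nu>))
      (\<lambda>U. - ?c * disj_avg ?Y (k - 1) (?D f) U)"
    using k by simp
  have "swap_lipschitz ?Y (k - 1) (?c * (real (k - 1) / (real (card X) - real k - 1) * \<nu>)) (?D (disj_avg X k f))"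
  proof (subst swap_lipschitz_cong)
    show "?D (disj_avg X k f) U = - ?c * disj_avg ?Y (k - 1) (?D f) U" if "U \<in> nsets ?Y (k - 1)" for U
    proof -
      have U: "a \<in> X - U" "b \<in> X - U" "U \<subseteq> X" "card U = k - 1" using that ab by (auto simp: nsets_def)
      then have "real (card X) - real (card U) - 1 = real (card X) - real k" using k by simp
      then show ?thesis using disj_avg_swap[OF X U(1,2) ab(3) U(3), of k f] by simp
    qed
  qed (use X * in auto)
  moreover have "?c * (real (k - 1) / (real (card X) - real k - 1) * \<nu>) =
      real k * (real k - 1) / ((real (card X) - real k) * (real (card X) - real k - 1)) * \<nu>"
    using k by (cases k) simp_all
  ultimately show "swap_lipschitz ?Y (k - 1)
    (real k * (real k - 1) / ((real (card X) - real k) * (real (card X) - real k - 1)) * \<nu>) (?D (disj_avg X k f))"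
    by (simp only:)
qed

lemma swap_lipschitz2_sup:
  assumes X: "finite X" and f: "swap_lipschitz2 X k \<nu> f" "star_free X k f" and \<nu>: "0 \<le> \<nu>" and k: "k \<noteq> 0"
    and A: "A \<in> nsets X k"
  shows "\<bar>f A\<bar> \<le> real k * (real (k - 1) * \<nu>)"
proof (rule swap_lipschitz_sup[OF X _ _ _ A])
  obtain i where i: "k = Suc i" using k not0_implies_Suc by blast
  show "swap_lipschitz X k (real (k - 1) * \<nu>) f"
    unfolding swap_lipschitz_def
  proof (intro allI impI)
    fix U a b assume U: "U \<subseteq> X" "Suc (card U) = k" and ab: "a \<in> X - U" "b \<in> X - U" "a \<noteq> b"
    have "U \<in> nsets (X - {a, b}) i" using U ab X finite_subset by (auto simp: nsets_def i)
    from swap_lipschitz_sup[OF _ _ \<nu> _ this, of "\<lambda>S. f (insert a S) - f (insert b S)"]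
    show "\<bar>f (insert a U) - f (insert b U)\<bar> \<le> real (k - 1) * \<nu>"
      using f ab X star_free_swap_sum[OF X, of i f a b] by (auto simp: i swap_lipschitz2_def)
  qed
  show "(\<Sum>A\<in>nsets X k. f A) = 0" by (rule star_free_sum[OF X f(2) k])
qed (use \<nu> in simp)

section \<open>Spectral bounds\<close>

text \<open>
On functions orthogonal to the stars, the Kneser operator contracts second swap differences by the
product of the two factors of \<open>disj_avg_swap\<close>, for sets of size \<open>k\<close> and \<open>k - 1\<close>.  Since these
differences control the function, \<open>norm_le_of_iterates_bounded\<close> turns this into a bound of the
quadratic form.
\<close>

lemma kneser_form_star_free:
  assumes X: "finite X" and k: "k + 1 < card X" "k \<noteq> 0" and f: "star_free X k f"
  shows "\<bar>avg (nsets X k) (\<lambda>A. f A * disj_avg X k f A)\<bar> \<le>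
    real k * (real k - 1) / ((real (card X) - real k) * (real (card X) - real k - 1)) *
    avg (nsets X k) (\<lambda>A. (f A)\<^sup>2)"
proof -
  let ?T = "disj_avg X k" and ?\<Omega> = "nsets X k"
  let ?r = "real k * (real k - 1) / ((real (card X) - real k) * (real (card X) - real k - 1))"
  have r: "?r \<ge> 0" using k by simp
  have fin: "finite ?\<Omega>" "?\<Omega> \<noteq> {}" using X k by (auto simp: finite_imp_finite_nsets nsets_eq_empty_iff)
  obtain \<nu> where \<nu>: "\<nu> \<ge> 0" "swap_lipschitz2 X k \<nu> f" using ex_swap_lipschitz2[OF X] by blast
  have iter: "star_free X k ((?T ^^ m) f) \<and> swap_lipschitz2 X k (?r ^ m * \<nu>) ((?T ^^ m) f)" for m
  proof (induction m)
    case (Suc m)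
    then show ?case
      using star_free_disj_avg[OF X _ k(2), of "(?T ^^ m) f"]
        swap_lipschitz2_disj_avg[OF X _ _ k, of "?r ^ m * \<nu>" "(?T ^^ m) f"] r \<nu>(1)
      by (simp add: mult.assoc)
  qed (use f \<nu> in simp)
  have "avg ?\<Omega> (\<lambda>x. (?T f x)\<^sup>2) \<le> ?r\<^sup>2 * avg ?\<Omega> (\<lambda>x. (f x)\<^sup>2)"
  proof (rule norm_le_of_iterates_bounded[OF fin _ _ r])
    show "avg ?\<Omega> (\<lambda>x. u x * ?T v x) = avg ?\<Omega> (\<lambda>x. ?T u x * v x)" for u v
      by (rule disj_avg_adjoint[OF X])
    show "\<bar>(?T ^^ m) f A\<bar> \<le> (real k * (real (k - 1) * \<nu>)) * ?r ^ m" if "A \<in> ?\<Omega>" for m A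
      using swap_lipschitz2_sup[OF X _ _ _ k(2) that, of "?r ^ m * \<nu>" "(?T ^^ m) f"] iter[of m] r \<nu>(1)
      by (simp add: mult.assoc mult.left_commute mult.commute)
  qed
  then have "(avg ?\<Omega> (\<lambda>A. f A * ?T f A))\<^sup>2 \<le> avg ?\<Omega> (\<lambda>A. (f A)\<^sup>2) * (?r\<^sup>2 * avg ?\<Omega> (\<lambda>A. (f A)\<^sup>2))"
    by (intro order_trans[OF avg_Cauchy_Schwarz] mult_left_mono avg_nonneg) auto
  also have "\<dots> = (?r * avg ?\<Omega> (\<lambda>A. (f A)\<^sup>2))\<^sup>2"
    by (simp only: power_mult_distrib power2_eq_square mult_ac)
  finally have "\<bar>avg ?\<Omega> (\<lambda>A. f A * ?T f A)\<bar> \<le> \<bar>?r * avg ?\<Omega> (\<lambda>A. (f A)\<^sup>2)\<bar>"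
    by (simp only: abs_le_square_iff)
  moreover have "?r * avg ?\<Omega> (\<lambda>A. (f A)\<^sup>2) \<ge> 0"
    by (intro mult_nonneg_nonneg r avg_nonneg) simp
  ultimately show ?thesis by (simp only: abs_of_nonneg)
qed

text \<open>
The first-order counterpart: for a function of mean zero it suffices to control first swap
differences.  The operator maps between different slices, so the iteration is applied to its
composition with the adjoint.
\<close>

lemma disj_avg_norm_mean_zero:
  assumes X: "finite X" and jk: "j + k < card X" and h: "(\<Sum>A\<in>nsets X j. h A) = 0"
  shows "avg (nsets X k) (\<lambda>B. (disj_avg X j h B)\<^sup>2) \<le>
    real j * real k / ((real (card X) - real j) * (real (card X) - real k)) * avg (nsets X j) (\<lambda>A. (h A)\<^sup>2)"
proof -
  let ?T = "\<lambda>u. disj_avg X k (disj_avg X j u)" and ?\<Omega> = "nsets X j"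
  let ?r = "real j * real k / ((real (card X) - real j) * (real (card X) - real k))"
  have r: "?r \<ge> 0" using jk by simp
  have fin: "finite ?\<Omega>" "?\<Omega> \<noteq> {}" using X jk by (auto simp: finite_imp_finite_nsets nsets_eq_empty_iff)
  have form: "avg ?\<Omega> (\<lambda>A. u A * ?T v A) = avg (nsets X k) (\<lambda>B. disj_avg X j u B * disj_avg X j v B)" for u v
    by (rule disj_avg_adjoint[OF X])
  have sym: "avg ?\<Omega> (\<lambda>A. u A * ?T v A) = avg ?\<Omega> (\<lambda>A. ?T u A * v A)" for u v
    using form[of u v] form[of v u] by (simp add: mult.commute)
  have mean: "(\<Sum>A\<in>?\<Omega>. ?T u A) = 0" if "(\<Sum>A\<in>?\<Omega>. u A) = 0" for u
  proof -
    have one: "?T (\<lambda>_. 1) A = 1" if "A \<in> ?\<Omega>" for A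
    proof -
      have "?T (\<lambda>_. 1) A = disj_avg X k (\<lambda>_. 1) A"
        using disj_avg_const[OF X, of _ k j 1] jk by (intro disj_avg_cong) auto
      then show ?thesis using disj_avg_const[OF X that, of k] jk by simp
    qed
    have "avg ?\<Omega> (\<lambda>A. ?T u A) = avg ?\<Omega> (\<lambda>A. ?T (\<lambda>_. 1) A * u A)"
      using sym[of "\<lambda>_. 1" u] by simp
    also have "\<dots> = avg ?\<Omega> u" by (intro avg_cong) (simp add: one)
    finally show ?thesis using that fin by (simp add: avg_def del: card_nsets)
  qed
  obtain \<nu> where \<nu>: "\<nu> \<ge> 0" "swap_lipschitz X j \<nu> h" using ex_swap_lipschitz[OF X] by blast
  have lip: "swap_lipschitz X j (?r * \<mu>) (?T u)" if "swap_lipschitz X j \<mu> u" "\<mu> \<ge> 0" for \<mu> u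
    using swap_lipschitz_disj_avg[OF X swap_lipschitz_disj_avg[OF X that, of k], of j] that jk
    by (simp add: mult_ac)
  have iter: "(\<Sum>A\<in>?\<Omega>. (?T ^^ m) h A) = 0 \<and> swap_lipschitz X j (?r ^ m * \<nu>) ((?T ^^ m) h)" for m
  proof (induction m)
    case (Suc m)
    then show ?case
      using mean[of "(?T ^^ m) h"] lip[of "?r ^ m * \<nu>" "(?T ^^ m) h"] r \<nu>(1)
      by (simp add: mult.assoc)
  qed (use h \<nu> in simp)
  have "avg ?\<Omega> (\<lambda>x. (?T h x)\<^sup>2) \<le> ?r\<^sup>2 * avg ?\<Omega> (\<lambda>x. (h x)\<^sup>2)"
  proof (rule norm_le_of_iterates_bounded[OF fin sym _ r])
    show "\<bar>(?T ^^ m) h A\<bar> \<le> (real j * \<nu>) * ?r ^ m" if "A \<in> ?\<Omega>" for m A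
      using swap_lipschitz_sup[OF X _ _ _ that, of "?r ^ m * \<nu>" "(?T ^^ m) h"] iter[of m] r \<nu>(1)
      by (simp add: mult.assoc mult.left_commute mult.commute)
  qed
  then have "(avg ?\<Omega> (\<lambda>A. h A * ?T h A))\<^sup>2 \<le> avg ?\<Omega> (\<lambda>A. (h A)\<^sup>2) * (?r\<^sup>2 * avg ?\<Omega> (\<lambda>A. (h A)\<^sup>2))"
    by (intro order_trans[OF avg_Cauchy_Schwarz] mult_left_mono avg_nonneg) auto
  also have "\<dots> = (?r * avg ?\<Omega> (\<lambda>A. (h A)\<^sup>2))\<^sup>2"
    by (simp only: power_mult_distrib power2_eq_square mult_ac)
  finally have "avg ?\<Omega> (\<lambda>A. h A * ?T h A) \<le> ?r * avg ?\<Omega> (\<lambda>A. (h A)\<^sup>2)"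
    by (rule power2_le_imp_le) (intro mult_nonneg_nonneg r avg_nonneg, simp)
  then show ?thesis unfolding form by (simp add: power2_eq_square)
qed

section \<open>Rademacher sums of nearly constant modulus\<close>

definition signed_sum :: "'a set \<Rightarrow> ('a \<Rightarrow> real) \<Rightarrow> 'a set \<Rightarrow> real" where
  "signed_sum L w t = (\<Sum>i\<in>L. if i \<in> t then - w i else w i)"

lemma avg_Pow_insert:
  assumes "finite L" "i \<notin> L"
  shows "avg (Pow (insert i L)) \<phi> = avg (Pow L) (\<lambda>t. (\<phi> t + \<phi> (insert i t)) / 2)"
proof -
  have inj: "inj_on (insert i) (Pow L)" using assms by (auto simp: inj_on_def)
  have "(\<Sum>t\<in>Pow (insert i L). \<phi> t) = (\<Sum>t\<in>Pow L. \<phi> t) + (\<Sum>t\<in>Pow L. \<phi> (insert i t))"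
    unfolding Pow_insert using assms
    by (subst sum.union_disjoint) (auto simp: sum.reindex[OF inj])
  then show ?thesis
    using assms by (simp add: avg_def card_Pow sum.distrib flip: sum_divide_distrib)
qed

lemma signed_sum_insert:
  assumes "finite L" "i \<notin> L" "t \<subseteq> L"
  shows "signed_sum (insert i L) w t = signed_sum L w t + w i"
    and "signed_sum (insert i L) w (insert i t) = signed_sum L w t - w i"
proof -
  have "i \<notin> t" using assms by blast
  then show "signed_sum (insert i L) w t = signed_sum L w t + w i"
    using assms by (simp add: signed_sum_def)
  have "(\<Sum>j\<in>L. if j \<in> insert i t then - w j else w j) = (\<Sum>j\<in>L. if j \<in> t then - w j else w j)"
    using assms by (intro sum.cong) auto
  then show "signed_sum (insert i L) w (insert i t) = signed_sum L w t - w i"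
    using assms by (simp add: signed_sum_def)
qed

text \<open>
The constant 3 in the fourth moment is the Gaussian one; only its being independent of the number of
weights matters below.
\<close>

lemma signed_sum_moments:
  assumes "finite L"
  shows "avg (Pow L) (\<lambda>t. (signed_sum L w t)\<^sup>2) = (\<Sum>i\<in>L. (w i)\<^sup>2)"
    and "avg (Pow L) (\<lambda>t. (signed_sum L w t) ^ 4) \<le> 3 * (\<Sum>i\<in>L. (w i)\<^sup>2)\<^sup>2"
  using assms
proof (induction L)
  case empty
  {
    case 1 then show ?case by (simp add: avg_def signed_sum_def)
  next
    case 2 then show ?case by (simp add: avg_def signed_sum_def)
  }
next
  case (insert i L)
  let ?Z = "signed_sum L w" and ?v = "\<Sum>i\<in>L. (w i)\<^sup>2"
  have fin: "finite (Pow L)" "Pow L \<noteq> {}" using insert.hyps by auto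
  {
    case 1
    have "avg (Pow (insert i L)) (\<lambda>t. (signed_sum (insert i L) w t)\<^sup>2) = avg (Pow L) (\<lambda>t. (?Z t)\<^sup>2 + (w i)\<^sup>2)"
      unfolding avg_Pow_insert[OF insert.hyps]
      by (intro avg_cong) (simp add: signed_sum_insert[OF insert.hyps] power2_eq_square algebra_simps)
    then show ?case
      using insert.IH(1) insert.hyps by (simp add: avg_add avg_const[OF fin] add.commute)
  next
    case 2
    have "avg (Pow (insert i L)) (\<lambda>t. (signed_sum (insert i L) w t) ^ 4) =
        avg (Pow L) (\<lambda>t. (?Z t) ^ 4 + (6 * (w i)\<^sup>2) * (?Z t)\<^sup>2 + (w i) ^ 4)"
      unfolding avg_Pow_insert[OF insert.hyps]
      by (intro avg_cong)
         (simp add: signed_sum_insert[OF insert.hyps] power2_eq_square power4_eq_xxxx algebra_simps)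
    also have "\<dots> = avg (Pow L) (\<lambda>t. (?Z t) ^ 4) + 6 * (w i)\<^sup>2 * ?v + (w i) ^ 4"
      by (simp only: avg_add avg_cmult avg_const[OF fin] insert.IH(1))
    also have "\<dots> \<le> 3 * ?v\<^sup>2 + 6 * (w i)\<^sup>2 * ?v + 3 * (w i) ^ 4"
    proof -
      have "0 \<le> w i ^ 4" by simp
      then show ?thesis using insert.IH(2) by linarith
    qed
    also have "\<dots> = 3 * (\<Sum>i\<in>insert i L. (w i)\<^sup>2)\<^sup>2"
      using insert.hyps by (simp add: power2_eq_square power4_eq_xxxx algebra_simps)
    finally show ?case .
  }
qed

lemma avg_Pow_Un_mult:
  assumes "finite I" "finite J" "I \<inter> J = {}"
  shows "avg (Pow (I \<union> J)) (\<lambda>t. F (t \<inter> I) * G (t \<inter> J)) = avg (Pow I) F * avg (Pow J) G"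
proof -
  have "(\<Sum>t\<in>Pow (I \<union> J). F (t \<inter> I) * G (t \<inter> J)) = (\<Sum>(p, q)\<in>Pow I \<times> Pow J. F p * G q)"
    by (rule sum.reindex_bij_witness[where i = "\<lambda>(p, q). p \<union> q" and j = "\<lambda>t. (t \<inter> I, t \<inter> J)"])
       (use assms(3) in \<open>auto 0 3 simp: Int_Un_distrib2 Int_absorb1 Int_absorb2\<close>)
  also have "\<dots> = (\<Sum>p\<in>Pow I. F p) * (\<Sum>q\<in>Pow J. G q)"
    by (simp add: sum_product sum.cartesian_product)
  finally show ?thesis
    using assms by (simp add: avg_def card_Pow card_Un_disjoint power_add)
qed

lemma signed_sum_Int: "signed_sum L w (t \<inter> L) = signed_sum L w t"
  unfolding signed_sum_def by (intro sum.cong) auto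

text \<open>
For \<open>a \<le> b\<close> the difference of the two sides is at least \<open>a * (1 - b / 6)\<^sup>2\<close>.  The point of a
polynomial lower bound is that its expectation for independent \<open>a\<close>, \<open>b\<close> is known from their first
two moments: means 1 and second moments at most 3 give \<open>1 / 3 - 6 / 36 = 1 / 6\<close>.
\<close>

lemma min_ge_polynomial:
  fixes a b :: real
  assumes "0 \<le> a" "0 \<le> b"
  shows "a * b / 3 - (a\<^sup>2 * b + a * b\<^sup>2) / 36 \<le> min a b"
proof -
  have *: "x * y / 3 - (x\<^sup>2 * y + x * y\<^sup>2) / 36 \<le> x" if "0 \<le> x" "x \<le> y" for x y :: real
  proof -
    have "x * (x * y) \<ge> 0" using that by simp
    moreover have "x * (1 - y / 6)\<^sup>2 \<ge> 0" using that by simp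
    ultimately show ?thesis by (simp add: power2_eq_square field_simps)
  qed
  show ?thesis
    using *[of a b] *[of b a] assms by (cases "a \<le> b") (simp_all add: mult.commute add.commute)
qed

text \<open>
The two sums are independent and, by the fourth moment bound, neither is concentrated near zero.
\<close>

lemma avg_min_signed_sums:
  assumes IJ: "finite I" "finite J" "I \<inter> J = {}"
  shows "min (\<Sum>i\<in>I. (w i)\<^sup>2) (\<Sum>j\<in>J. (w j)\<^sup>2) / 6 \<le>
    avg (Pow (I \<union> J)) (\<lambda>t. min ((signed_sum I w t)\<^sup>2) ((signed_sum J w t)\<^sup>2))"
proof -
  let ?X = "signed_sum I w" and ?Y = "signed_sum J w" and ?\<Omega> = "Pow (I \<union> J)"
  define p q where "p = (\<Sum>i\<in>I. (w i)\<^sup>2)" and "q = (\<Sum>j\<in>J. (w j)\<^sup>2)"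
  have nonneg: "p \<ge> 0" "q \<ge> 0" by (simp_all add: p_def q_def sum_nonneg)
  show ?thesis
  proof (cases "p = 0 \<or> q = 0")
    case True
    then have "min p q = 0" using nonneg by auto
    then show ?thesis unfolding p_def[symmetric] q_def[symmetric]
      by (simp add: avg_nonneg)
  next
    case False
    then have pos: "p > 0" "q > 0" using nonneg by auto
    define a where "a = (\<lambda>t. (?X t)\<^sup>2 / p)"
    define b where "b = (\<lambda>t. (?Y t)\<^sup>2 / q)"
    have prod: "avg ?\<Omega> (\<lambda>t. a t ^ m * b t ^ n) = avg (Pow I) (\<lambda>t. a t ^ m) * avg (Pow J) (\<lambda>t. b t ^ n)" for m n
      using avg_Pow_Un_mult[OF IJ, of "\<lambda>t. a t ^ m" "\<lambda>t. b t ^ n"] by (simp add: a_def b_def signed_sum_Int)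
    have a1: "avg (Pow I) a = 1" and b1: "avg (Pow J) b = 1"
      using signed_sum_moments(1)[OF IJ(1), of w] signed_sum_moments(1)[OF IJ(2), of w] pos
      by (simp_all add: a_def b_def avg_divide p_def q_def)
    have a2: "avg (Pow I) (\<lambda>t. a t ^ 2) \<le> 3" and b2: "avg (Pow J) (\<lambda>t. b t ^ 2) \<le> 3"
      using signed_sum_moments(2)[OF IJ(1), of w] signed_sum_moments(2)[OF IJ(2), of w] pos
      by (simp_all add: a_def b_def power_divide avg_divide divide_le_eq flip: p_def q_def power_mult)
    have "1 / 6 \<le> avg ?\<Omega> (\<lambda>t. a t ^ 1 * b t ^ 1) / 3 - (avg ?\<Omega> (\<lambda>t. a t ^ 2 * b t ^ 1) + avg ?\<Omega> (\<lambda>t. a t ^ 1 * b t ^ 2)) / 36"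
      unfolding prod using a1 b1 a2 b2 by simp
    also have "\<dots> = avg ?\<Omega> (\<lambda>t. a t * b t / 3 - ((a t)\<^sup>2 * b t + a t * (b t)\<^sup>2) / 36)"
      by (simp add: avg_def sum_subtractf sum.distrib add_divide_distrib diff_divide_distrib flip: sum_divide_distrib)
    also have "\<dots> \<le> avg ?\<Omega> (\<lambda>t. min (a t) (b t))"
      using nonneg by (intro avg_mono min_ge_polynomial) (simp_all add: a_def b_def)
    finally have "min p q * (1 / 6) \<le> min p q * avg ?\<Omega> (\<lambda>t. min (a t) (b t))"
      using pos by (intro mult_left_mono) auto
    also have "\<dots> = avg ?\<Omega> (\<lambda>t. min p q * min (a t) (b t))" by (rule avg_cmult[symmetric])
    also have "\<dots> \<le> avg ?\<Omega> (\<lambda>t. min ((?X t)\<^sup>2) ((?Y t)\<^sup>2))"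
    proof (rule avg_mono)
      fix t
      have "min p q * min (a t) (b t) \<le> p * a t" "min p q * min (a t) (b t) \<le> q * b t"
        using pos by (intro mult_mono; simp add: a_def b_def)+
      then show "min p q * min (a t) (b t) \<le> min ((?X t)\<^sup>2) ((?Y t)\<^sup>2)"
        using pos by (simp add: a_def b_def)
    qed
    finally show ?thesis unfolding p_def q_def by simp
  qed
qed

text \<open>
A single term above \<open>m\<close> can be split off.  If there is none and the total exceeds \<open>m\<close>, a maximal
set of terms with sum at most \<open>m\<close>, enlarged by one more term, has a sum between \<open>m\<close> and \<open>2 * m\<close>; so
its complement sums to at most \<open>m\<close>, and the total is at most \<open>3 * m\<close>.
\<close>

lemma dominant_term_of_splits:
  fixes p :: "'a \<Rightarrow> real"
  assumes L: "finite L" "L \<noteq> {}" and p: "\<And>i. i \<in> L \<Longrightarrow> 0 \<le> p i"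
    and split: "\<And>I. I \<subseteq> L \<Longrightarrow> min (sum p I) (sum p (L - I)) \<le> m"
  shows "\<exists>i\<in>L. sum p (L - {i}) \<le> 3 * m"
proof -
  have v0: "0 \<le> sum p L" using p by (rule sum_nonneg)
  then have m0: "0 \<le> m" using split[of "{}"] by simp
  show ?thesis
  proof (cases "\<exists>i\<in>L. p i > m")
    case True
    then obtain i where "i \<in> L" "p i > m" by blast
    then show ?thesis using split[of "{i}"] m0 by (intro bexI[of _ i]) auto
  next
    case False
    have "sum p L \<le> 3 * m"
    proof (rule ccontr)
      assume big: "\<not> sum p L \<le> 3 * m"
      have "finite {I. I \<subseteq> L \<and> sum p I \<le> m}" "{I. I \<subseteq> L \<and> sum p I \<le> m} \<noteq> {}"
        using L m0 by (auto intro: exI[of _ "{}"])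
      from finite_has_maximal[OF this] obtain I where I: "I \<subseteq> L" "sum p I \<le> m"
        and max: "\<And>I'. I' \<subseteq> L \<Longrightarrow> sum p I' \<le> m \<Longrightarrow> I \<subseteq> I' \<Longrightarrow> I = I'" by auto
      have "I \<noteq> L" using I big m0 by auto
      then obtain i where i: "i \<in> L" "i \<notin> I" using I by blast
      have fI: "finite I" using I L finite_subset by blast
      have s: "sum p (insert i I) = p i + sum p I" using fI i by simp
      have "sum p (insert i I) > m"
      proof (rule ccontr)
        assume "\<not> sum p (insert i I) > m"
        then have "I = insert i I" using max[of "insert i I"] i I by auto
        then show False using i by blast
      qed
      moreover have "sum p (L - insert i I) = sum p L - sum p (insert i I)"
        using i I L by (subst sum_diff) auto
      moreover have "sum p (insert i I) \<le> 2 * m"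
      proof -
        have "p i \<le> m" using False i by auto
        then show ?thesis using s I by linarith
      qed
      ultimately show False using split[of "insert i I"] big i I by (simp add: min_def split: if_splits)
    qed
    moreover obtain i where i: "i \<in> L" using L by blast
    moreover have "sum p (L - {i}) \<le> sum p L" using L p by (intro sum_mono2) auto
    ultimately have "sum p (L - {i}) \<le> 3 * m" by linarith
    then show ?thesis using i by blast
  qed
qed

lemma abs_diff_square_eq_min: "(\<bar>x + y\<bar> - \<bar>x - y\<bar>)\<^sup>2 = 4 * min (x\<^sup>2) (y\<^sup>2)" for x y :: real
proof -
  have "(\<bar>x + y\<bar> - \<bar>x - y\<bar>)\<^sup>2 = (x + y)\<^sup>2 + (x - y)\<^sup>2 - 2 * \<bar>(x + y) * (x - y)\<bar>"
    by (simp add: power2_diff abs_mult)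
  also have "(x + y) * (x - y) = x\<^sup>2 - y\<^sup>2" by (simp add: power2_eq_square algebra_simps)
  also have "(x + y)\<^sup>2 + (x - y)\<^sup>2 = 2 * (x\<^sup>2 + y\<^sup>2)" by (simp add: power2_eq_square algebra_simps)
  finally show ?thesis by (simp add: min_def abs_if)
qed

lemma square_sum2_le: "(x + y)\<^sup>2 \<le> 2 * x\<^sup>2 + 2 * y\<^sup>2" for x y :: real
  using sum_squares_bound[of x y] by (simp add: power2_sum)

lemma square_sum3_le: "(x + y + z)\<^sup>2 \<le> 3 * (x\<^sup>2 + y\<^sup>2 + z\<^sup>2)" for x y z :: real
proof -
  have "(x - y)\<^sup>2 + (y - z)\<^sup>2 + (x - z)\<^sup>2 \<ge> 0" by simp
  then show ?thesis by (simp add: power2_eq_square algebra_simps)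
qed

text \<open>
A robust form of the theorem of Friedgut, Kalai and Naor for linear functions: if the modulus of a
Rademacher sum is nearly constant, then the constant is nearly the modulus of one of the weights.
Here \<open>a\<close> approximates the modulus, \<open>e\<close> measures the error and \<open>b\<close> the failure of \<open>a\<close> to be constant.

Split the sum as \<open>X + Y\<close> along any set \<open>I\<close> of indices.  Changing all signs in \<open>Y\<close> hardly changes the
modulus, and \<open>\<bar>X + Y\<bar>\<close> and \<open>\<bar>X - Y\<bar>\<close> differ by twice the smaller one of \<open>\<bar>X\<bar>\<close> and \<open>\<bar>Y\<bar>\<close>.  As
\<open>X\<close> and \<open>Y\<close> are independent, one of them has small variance.  This holds for every split, so all
weights but one are negligible.
\<close>

lemma rademacher_dominant_weight:
  assumes L: "finite L" "L \<noteq> {}"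
    and e: "\<And>t. t \<subseteq> L \<Longrightarrow> (\<bar>signed_sum L w t\<bar> - a t)\<^sup>2 \<le> e t"
    and b: "\<And>t t'. t \<subseteq> L \<Longrightarrow> t' \<subseteq> L \<Longrightarrow> (a t - a t')\<^sup>2 \<le> b t + b t'"
  shows "\<exists>i\<in>L. avg (Pow L) (\<lambda>t. (\<bar>w i\<bar> - a t)\<^sup>2) \<le> 56 * avg (Pow L) (\<lambda>t. e t + b t)"
proof -
  let ?Z = "signed_sum L w" and ?E = "avg (Pow L) (\<lambda>t. e t + b t)"
  \<comment> \<open>the signs are changed outside of \<open>I\<close>\<close>
  have split: "min (\<Sum>i\<in>I. (w i)\<^sup>2) (\<Sum>i\<in>L - I. (w i)\<^sup>2) \<le> 9 * ?E" if I: "I \<subseteq> L" for I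
  proof -
    define flip where "flip t = (t - (L - I)) \<union> ((L - I) - t)" for t
    let ?X = "signed_sum I w" and ?Y = "signed_sum (L - I) w"
    have fI: "finite I" using I L finite_subset by blast
    have U: "I \<union> (L - I) = L" using I by auto
    have Z: "?Z t = signed_sum I w t + signed_sum (L - I) w t" for t
      unfolding signed_sum_def by (subst sum.subset_diff[OF I L(1)]) (rule add.commute)
    have Z': "?Z (flip t) = ?X t - ?Y t" for t
    proof -
      have "?X (flip t) = ?X t" unfolding signed_sum_def flip_def by (intro sum.cong) auto
      moreover have "?Y (flip t) = - ?Y t"
        unfolding signed_sum_def flip_def sum_negf[symmetric] by (intro sum.cong) auto
      ultimately show ?thesis using Z[of "flip t"] by simp
    qed
    have fl: "flip t \<subseteq> L" if "t \<subseteq> L" for t using that by (auto simp: flip_def)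
    have bij: "bij_betw flip (Pow L) (Pow L)"
      by (rule bij_betwI[of _ _ _ flip]) (auto simp: flip_def)
    have point: "4 * min ((?X t)\<^sup>2) ((?Y t)\<^sup>2) \<le> 3 * (e t + b t) + 3 * (e (flip t) + b (flip t))" if t: "t \<subseteq> L" for t
    proof -
      have "4 * min ((?X t)\<^sup>2) ((?Y t)\<^sup>2) = (\<bar>?Z t\<bar> - \<bar>?Z (flip t)\<bar>)\<^sup>2"
        unfolding Z' Z[of t] abs_diff_square_eq_min ..
      also have "\<dots> = ((\<bar>?Z t\<bar> - a t) + (a t - a (flip t)) + (a (flip t) - \<bar>?Z (flip t)\<bar>))\<^sup>2" by simp
      also have "\<dots> \<le> 3 * ((\<bar>?Z t\<bar> - a t)\<^sup>2 + (a t - a (flip t))\<^sup>2 + (a (flip t) - \<bar>?Z (flip t)\<bar>)\<^sup>2)"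
        by (rule square_sum3_le)
      also have "\<dots> \<le> 3 * (e t + (b t + b (flip t)) + e (flip t))"
        using e[OF t] e[OF fl[OF t]] b[OF t fl[OF t]] by (simp add: power2_commute)
      finally show ?thesis by simp
    qed
    have "min (\<Sum>i\<in>I. (w i)\<^sup>2) (\<Sum>i\<in>L - I. (w i)\<^sup>2) / 6 \<le> avg (Pow L) (\<lambda>t. min ((?X t)\<^sup>2) ((?Y t)\<^sup>2))"
      using avg_min_signed_sums[of I "L - I" w] fI L unfolding U by simp
    also have "4 * \<dots> \<le> avg (Pow L) (\<lambda>t. 3 * (e t + b t) + 3 * (e (flip t) + b (flip t)))"
      unfolding avg_cmult[symmetric] using point by (intro avg_mono) auto
    also have "\<dots> = 3 * ?E + 3 * avg (Pow L) (\<lambda>t. e (flip t) + b (flip t))"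
      by (simp only: avg_add avg_cmult)
    also have "avg (Pow L) (\<lambda>t. e (flip t) + b (flip t)) = ?E"
      unfolding avg_def using sum.reindex_bij_betw[OF bij, of "\<lambda>t. e t + b t"] by simp
    finally show ?thesis by simp
  qed
  obtain i where i: "i \<in> L" "(\<Sum>j\<in>L - {i}. (w j)\<^sup>2) \<le> 27 * ?E"
  proof -
    have "\<exists>i\<in>L. (\<Sum>j\<in>L - {i}. (w j)\<^sup>2) \<le> 3 * (9 * ?E)"
      by (rule dominant_term_of_splits[OF L _ split]) simp_all
    then show ?thesis using that by auto
  qed
  let ?Y = "signed_sum (L - {i}) w"
  have point: "(\<bar>w i\<bar> - a t)\<^sup>2 \<le> 2 * (?Y t)\<^sup>2 + 2 * e t" if t: "t \<subseteq> L" for t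
  proof -
    have "?Z t = (if i \<in> t then - w i else w i) + ?Y t"
      unfolding signed_sum_def using i L by (simp add: sum.remove)
    then have "\<bar>\<bar>w i\<bar> - \<bar>?Z t\<bar>\<bar> \<le> \<bar>?Y t\<bar>" by (auto split: if_splits)
    then have *: "(\<bar>w i\<bar> - \<bar>?Z t\<bar>)\<^sup>2 \<le> (?Y t)\<^sup>2" by (simp add: abs_le_square_iff)
    have "(\<bar>w i\<bar> - a t)\<^sup>2 = ((\<bar>w i\<bar> - \<bar>?Z t\<bar>) + (\<bar>?Z t\<bar> - a t))\<^sup>2" by simp
    also have "\<dots> \<le> 2 * (\<bar>w i\<bar> - \<bar>?Z t\<bar>)\<^sup>2 + 2 * (\<bar>?Z t\<bar> - a t)\<^sup>2"
      by (rule square_sum2_le)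
    finally show ?thesis using * e[OF t] by linarith
  qed
  have b0: "b t \<ge> 0" if "t \<subseteq> L" for t using b[OF that that] by simp
  have "avg (Pow L) (\<lambda>t. (\<bar>w i\<bar> - a t)\<^sup>2) \<le> avg (Pow L) (\<lambda>t. 2 * (?Y t)\<^sup>2 + 2 * (e t + b t))"
  proof (rule avg_mono)
    fix t assume "t \<in> Pow L"
    then show "(\<bar>w i\<bar> - a t)\<^sup>2 \<le> 2 * (?Y t)\<^sup>2 + 2 * (e t + b t)" using point[of t] b0[of t] by simp
  qed
  also have "\<dots> = 2 * avg (Pow L) (\<lambda>t. (?Y t)\<^sup>2) + 2 * ?E" by (simp only: avg_add avg_cmult)
  also have "avg (Pow L) (\<lambda>t. (?Y t)\<^sup>2) = (\<Sum>j\<in>L - {i}. (w j)\<^sup>2)"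
  proof -
    have U: "L = (L - {i}) \<union> {i}" using i by auto
    have "avg (Pow ((L - {i}) \<union> {i})) (\<lambda>t. (?Y (t \<inter> (L - {i})))\<^sup>2 * 1) =
        avg (Pow (L - {i})) (\<lambda>t. (?Y t)\<^sup>2) * avg (Pow {i}) (\<lambda>_. 1)"
      using L by (intro avg_Pow_Un_mult[where G = "\<lambda>_. 1"]) auto
    moreover have "avg (Pow {i}) (\<lambda>_. 1) = 1" by (intro avg_const) auto
    ultimately show ?thesis
      using L i by (simp add: signed_sum_Int signed_sum_moments(1) insert_absorb)
  qed
  finally have "avg (Pow L) (\<lambda>t. (\<bar>w i\<bar> - a t)\<^sup>2) \<le> 56 * ?E" using i(2) by linarith
  then show ?thesis using i(1) by blast
qed

section \<open>Random permutations\<close>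

lemma avg_permutations_compose:
  assumes "\<tau> permutes X"
  shows "avg {\<sigma>. \<sigma> permutes X} (\<lambda>\<sigma>. \<psi> (\<sigma> \<circ> \<tau>)) = avg {\<sigma>. \<sigma> permutes X} \<psi>"
  unfolding avg_def using sum_permutations_compose_right[OF assms, of \<psi>] by simp

lemma ex_permutation_mapping_pair:
  assumes X: "finite X" and I: "I \<subseteq> X" "J \<subseteq> X" "I \<inter> J = {}" and A: "A \<subseteq> X" "B \<subseteq> X" "A \<inter> B = {}"
    and c: "card A = card I" "card B = card J"
  shows "\<exists>\<rho>. \<rho> permutes X \<and> \<rho> ` I = A \<and> \<rho> ` J = B"
proof -
  have fin: "finite I" "finite J" "finite A" "finite B" using X I A finite_subset by blast+
  obtain f where f: "bij_betw f I A" using finite_same_card_bij[OF fin(1,3)] c by auto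
  obtain g where g: "bij_betw g J B" using finite_same_card_bij[OF fin(2,4)] c by auto
  have "card (X - (I \<union> J)) = card (X - (A \<union> B))"
    using fin I A c by (simp add: card_Diff_subset card_Un_disjoint)
  then obtain h where h: "bij_betw h (X - (I \<union> J)) (X - (A \<union> B))"
    using finite_same_card_bij[of "X - (I \<union> J)" "X - (A \<union> B)"] X by auto
  define \<rho> where "\<rho> x = (if x \<in> I then f x else if x \<in> J then g x else if x \<in> X then h x else x)" for x
  have f': "bij_betw \<rho> I A" using f by (rule bij_betw_cong[THEN iffD1, rotated]) (simp add: \<rho>_def)
  have g': "bij_betw \<rho> J B" using g by (rule bij_betw_cong[THEN iffD1, rotated]) (use I in \<open>auto simp: \<rho>_def\<close>)
  have h': "bij_betw \<rho> (X - (I \<union> J)) (X - (A \<union> B))"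
    using h by (rule bij_betw_cong[THEN iffD1, rotated]) (auto simp: \<rho>_def)
  have "bij_betw \<rho> ((I \<union> J) \<union> (X - (I \<union> J))) ((A \<union> B) \<union> (X - (A \<union> B)))"
    by (intro bij_betw_combine f' g' h') (use A in auto)
  moreover have "(I \<union> J) \<union> (X - (I \<union> J)) = X" "(A \<union> B) \<union> (X - (A \<union> B)) = X" using I A by auto
  ultimately have "\<rho> permutes X"
    using I by (intro bij_imp_permutes) (auto simp: \<rho>_def)
  then show ?thesis using f' g' by (auto simp: bij_betw_def)
qed

text \<open>
The mean on the right is invariant under every permutation; averaging over all permutations and
exchanging the averages reduces it to the orbit of one pair, because the permutations act
transitively on pairs of disjoint sets of given sizes.
\<close>

lemma avg_permutations_pair:
  assumes X: "finite X" and IJ: "I \<subseteq> X" "J \<subseteq> X" "I \<inter> J = {}"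
  shows "avg {\<sigma>. \<sigma> permutes X} (\<lambda>\<sigma>. F (\<sigma> ` I) (\<sigma> ` J)) =
    avg (nsets X (card I)) (\<lambda>A. avg (nsets (X - A) (card J)) (F A))"
proof -
  let ?P = "{\<sigma>. \<sigma> permutes X}" and ?\<Omega> = "nsets X (card I)" and ?N = "\<lambda>A. nsets (X - A) (card J)"
  have finP: "finite ?P" "?P \<noteq> {}" using X finite_permutations permutes_id by blast+
  have fin: "finite I" "finite J" using IJ X finite_subset by blast+
  have fin\<Omega>: "finite ?\<Omega>" "?\<Omega> \<noteq> {}" using fin IJ X by (auto simp: finite_imp_finite_nsets nsets_def)
  have finN: "finite (?N A)" "?N A \<noteq> {}" if "A \<in> ?\<Omega>" for A
  proof -
    have "card (I \<union> J) \<le> card X" using IJ X by (intro card_mono) auto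
    then have "card J \<le> card (X - A)"
      using that fin IJ X by (auto simp: nsets_def card_Diff_subset card_Un_disjoint)
    then show "finite (?N A)" "?N A \<noteq> {}"
      using X by (auto simp: finite_imp_finite_nsets nsets_eq_empty_iff)
  qed
  have inv: "avg ?\<Omega> (\<lambda>A. avg (?N A) (\<lambda>B. F (\<tau> ` A) (\<tau> ` B))) = avg ?\<Omega> (\<lambda>A. avg (?N A) (F A))"
    if \<tau>: "\<tau> permutes X" for \<tau>
  proof -
    have bij: "bij_betw \<tau> X X" using \<tau> by (rule permutes_imp_bij)
    have "avg (?N A) (\<lambda>B. F (\<tau> ` A) (\<tau> ` B)) = avg (?N (\<tau> ` A)) (F (\<tau> ` A))" if "A \<in> ?\<Omega>" for A
    proof -
      have "bij_betw \<tau> (X - A) (X - \<tau> ` A)"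
        using permutes_inj_on[OF \<tau>] image_set_diff[OF permutes_inj[OF \<tau>], of X A] permutes_image[OF \<tau>]
        by (intro bij_betw_imageI) simp_all
      then have b: "bij_betw ((`) \<tau>) (?N A) (?N (\<tau> ` A))" by (rule bij_betw_nsets)
      show ?thesis
        using sum.reindex_bij_betw[OF b, of "F (\<tau> ` A)"] bij_betw_same_card[OF b] by (simp add: avg_def)
    qed
    then have "avg ?\<Omega> (\<lambda>A. avg (?N A) (\<lambda>B. F (\<tau> ` A) (\<tau> ` B))) = avg ?\<Omega> (\<lambda>A. avg (?N (\<tau> ` A)) (F (\<tau> ` A)))"
      by (rule avg_cong)
    also have "\<dots> = avg ?\<Omega> (\<lambda>A. avg (?N A) (F A))"
      unfolding avg_def[of ?\<Omega>]
      using sum.reindex_bij_betw[OF bij_betw_nsets[OF bij], of "\<lambda>A. avg (?N A) (F A)"] by simp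
    finally show ?thesis .
  qed
  have orbit: "avg ?P (\<lambda>\<tau>. F (\<tau> ` A) (\<tau> ` B)) = avg ?P (\<lambda>\<sigma>. F (\<sigma> ` I) (\<sigma> ` J))"
    if AB: "A \<in> ?\<Omega>" "B \<in> ?N A" for A B
  proof -
    obtain \<rho> where \<rho>: "\<rho> permutes X" "\<rho> ` I = A" "\<rho> ` J = B"
      using ex_permutation_mapping_pair[OF X IJ, of A B] AB by (auto simp: nsets_def)
    show ?thesis
      using avg_permutations_compose[OF \<rho>(1), of "\<lambda>\<sigma>. F (\<sigma> ` I) (\<sigma> ` J)"]
      by (simp only: image_comp[symmetric] \<rho>)
  qed
  have "avg ?\<Omega> (\<lambda>A. avg (?N A) (F A)) = avg ?P (\<lambda>\<tau>. avg ?\<Omega> (\<lambda>A. avg (?N A) (\<lambda>B. F (\<tau> ` A) (\<tau> ` B))))"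
    using avg_const[OF finP] by (subst avg_cong[where g = "\<lambda>_. avg ?\<Omega> (\<lambda>A. avg (?N A) (F A))"]) (auto simp: inv)
  also have "\<dots> = avg ?\<Omega> (\<lambda>A. avg (?N A) (\<lambda>B. avg ?P (\<lambda>\<tau>. F (\<tau> ` A) (\<tau> ` B))))"
    by (subst avg_swap) (subst avg_swap, rule refl)
  also have "\<dots> = avg ?\<Omega> (\<lambda>A. avg (?N A) (\<lambda>B. avg ?P (\<lambda>\<sigma>. F (\<sigma> ` I) (\<sigma> ` J))))"
    by (rule avg_cong, rule avg_cong, rule orbit)
  also have "\<dots> = avg ?\<Omega> (\<lambda>A. avg ?P (\<lambda>\<sigma>. F (\<sigma> ` I) (\<sigma> ` J)))"
    by (intro avg_cong avg_const finN)
  also have "\<dots> = avg ?P (\<lambda>\<sigma>. F (\<sigma> ` I) (\<sigma> ` J))"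
    by (intro avg_const fin\<Omega>)
  finally show ?thesis ..
qed

lemma avg_permutations_image:
  assumes "finite X" "I \<subseteq> X"
  shows "avg {\<sigma>. \<sigma> permutes X} (\<lambda>\<sigma>. f (\<sigma> ` I)) = avg (nsets X (card I)) f"
  using avg_permutations_pair[OF assms, of "{}" "\<lambda>A _. f A"] by (simp add: avg_def)

text \<open>
The first \<open>2 * k\<close> numbers are matched into the pairs \<open>i\<close>, \<open>i + k\<close> with \<open>i\<close> in \<open>{1..k}\<close>; the two
members are exchanged in those pairs whose index \<open>i\<close> lies in \<open>t\<close>.
\<close>

definition pair_flip :: "nat \<Rightarrow> nat set \<Rightarrow> nat \<Rightarrow> nat" where
  "pair_flip k t y =
    (if y \<in> {1..k} \<inter> t then y + k else if y \<in> {k+1..2*k} \<and> y - k \<in> t then y - k else y)"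

lemma pair_flip_permutes:
  assumes "2 * k \<le> n"
  shows "pair_flip k t permutes {1..n}"
proof (rule bij_imp_permutes)
  show "bij_betw (pair_flip k t) {1..n} {1..n}"
    by (rule bij_betwI[of _ _ _ "pair_flip k t"]) (use assms in \<open>auto simp: pair_flip_def\<close>)
qed (use assms in \<open>auto simp: pair_flip_def\<close>)

section \<open>Families meeting every partition into k-sets\<close>

definition block :: "nat \<Rightarrow> nat \<Rightarrow> nat set" where
  "block k j = {j * k + 1..j * k + k}"

lemma card_block [simp]: "card (block k j) = k"
  by (simp add: block_def)

lemma block_subset: "j < s \<Longrightarrow> block k j \<subseteq> {1..s * k}"
proof -
  assume "j < s"
  then have "Suc j * k \<le> s * k" by (intro mult_right_mono) auto
  then show ?thesis by (auto simp: block_def)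
qed

lemma block_disjoint: "i < j \<Longrightarrow> block k i \<inter> block k j = {}"
proof -
  assume "i < j"
  then have "Suc i * k \<le> j * k" by (intro mult_right_mono) auto
  then show ?thesis by (auto simp: block_def)
qed

text \<open>
The images of the \<open>s\<close> consecutive blocks under a permutation form an arbitrary partition of the
ground set into \<open>k\<close>-sets.  The complement of a family without \<open>s\<close> pairwise disjoint members meets
every such partition.
\<close>

locale matching_transversal =
  fixes s k :: nat and G :: "nat set set"
  assumes s: "3 \<le> s" and k: "1 \<le> k" and G: "G \<subseteq> nsets {1..s * k} k"
    and transversal: "\<And>\<sigma>. \<sigma> permutes {1..s * k} \<Longrightarrow> \<exists>j<s. \<sigma> ` block k j \<in> G"
begin

definition "X = {1..s * k}"
definition "\<Omega> = nsets X k"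
definition "P = {\<sigma>. \<sigma> permutes X}"
definition g :: "nat set \<Rightarrow> real" where "g A = of_bool (A \<in> G)"
definition "\<alpha> = avg \<Omega> g"
definition "\<tau> = real s * \<alpha> - 1"
text \<open>
The degree of \<open>x\<close> in \<open>G\<close>, as a fraction of the size of the full star of \<open>x\<close>.
\<close>

definition "\<mu> x = avg (nsets (X - {x}) (k - 1)) (\<lambda>S. g (insert x S))"
definition "excess \<sigma> = (\<Sum>j<s. g (\<sigma> ` block k j)) - 1"

lemma g_cases: "g A = 0 \<or> g A = 1"
  by (simp add: g_def)

lemma g_square: "(g A)\<^sup>2 = g A"
  by (simp add: g_def)

lemma g_nonneg: "0 \<le> g A"
  by (simp add: g_def)

lemma finite_X [simp]: "finite X"
  by (simp add: X_def)

lemma card_X: "card X = s * k"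
  by (simp add: X_def)

lemma bounds: "3 * k \<le> s * k" "k + 1 < card X" "2 * k < card X"
proof -
  show *: "3 * k \<le> s * k" using s by (intro mult_right_mono) auto
  show "k + 1 < card X" "2 * k < card X" unfolding card_X using * k by linarith+
qed

lemma fin\<Omega>: "finite \<Omega>" "\<Omega> \<noteq> {}"
  using bounds by (auto simp: \<Omega>_def finite_imp_finite_nsets nsets_eq_empty_iff)

lemma finP: "finite P" "P \<noteq> {}"
  unfolding P_def using finite_permutations[OF finite_X] permutes_id by blast+

lemma avg_P_compose: "\<rho> permutes X \<Longrightarrow> avg P (\<lambda>\<sigma>. \<psi> (\<sigma> \<circ> \<rho>)) = avg P \<psi>"
  unfolding P_def by (rule avg_permutations_compose)

lemma avg_P_block: "j < s \<Longrightarrow> avg P (\<lambda>\<sigma>. f (\<sigma> ` block k j)) = avg \<Omega> f"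
  unfolding P_def \<Omega>_def using avg_permutations_image[OF finite_X, of "block k j" f] block_subset
  by (simp add: X_def)

lemma avg_P_blocks: "avg P (\<lambda>\<sigma>. F (\<sigma> ` block k 0) (\<sigma> ` block k 1)) = avg \<Omega> (\<lambda>A. avg (nsets (X - A) k) (F A))"
  unfolding P_def \<Omega>_def
  using avg_permutations_pair[OF finite_X, of "block k 0" "block k 1" F] block_subset[of _ s k] block_disjoint[of 0 1 k] s
  by (simp add: X_def)

lemma excess_nonneg: "\<sigma> \<in> P \<Longrightarrow> 0 \<le> excess \<sigma>"
proof -
  assume "\<sigma> \<in> P"
  then obtain j where j: "j < s" "\<sigma> ` block k j \<in> G" using transversal by (auto simp: P_def X_def)
  have "g (\<sigma> ` block k j) \<le> (\<Sum>j<s. g (\<sigma> ` block k j))"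
    using j by (intro member_le_sum) (auto simp: g_nonneg)
  then show ?thesis using j by (simp add: excess_def g_def)
qed

lemma excess_cases:
  assumes "\<sigma> \<in> P"
  shows "excess \<sigma> = 0 \<or> 1 \<le> excess \<sigma>"
proof -
  obtain i where i: "excess \<sigma> = real_of_int i"
  proof
    show "excess \<sigma> = real_of_int (int (card {j\<in>{..<s}. \<sigma> ` block k j \<in> G}) - 1)"
      unfolding excess_def g_def by (simp add: Int_def)
  qed
  then have "0 \<le> i" using excess_nonneg[OF assms] by simp
  then have "i = 0 \<or> 1 \<le> i" by linarith
  then show ?thesis by (auto simp: i)
qed

text \<open>
The quantity \<open>\<tau>\<close> is the expected surplus of members of \<open>G\<close> in a random partition, which is never
negative.  In particular \<open>G\<close> has density at least \<open>1 / s\<close>.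
\<close>

lemma avg_excess: "avg P excess = \<tau>"
proof -
  have "avg P (\<lambda>\<sigma>. \<Sum>j<s. g (\<sigma> ` block k j)) = (\<Sum>j<s. avg P (\<lambda>\<sigma>. g (\<sigma> ` block k j)))"
    unfolding avg_def sum_divide_distrib[symmetric] by (subst sum.swap) simp
  also have "\<dots> = real s * \<alpha>" by (simp add: avg_P_block \<alpha>_def)
  finally show ?thesis
    unfolding excess_def by (simp add: avg_diff avg_const[OF finP] \<tau>_def)
qed

lemma \<tau>_nonneg: "0 \<le> \<tau>"
  using avg_nonneg[of P excess, OF excess_nonneg] avg_excess by simp

lemma two_blocks_le_excess:
  assumes "\<sigma> \<in> P"
  shows "g (\<sigma> ` block k 0) * g (\<sigma> ` block k 1) \<le> excess \<sigma>"
proof -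
  have "{..<s} = {0, 1} \<union> {2..<s}" using s by auto
  then have "(\<Sum>j<s. g (\<sigma> ` block k j)) =
      g (\<sigma> ` block k 0) + g (\<sigma> ` block k 1) + (\<Sum>j=2..<s. g (\<sigma> ` block k j))"
    by (simp add: sum.union_disjoint)
  moreover have "(\<Sum>j=2..<s. g (\<sigma> ` block k j)) \<ge> 0" by (intro sum_nonneg) (simp add: g_nonneg)
  ultimately show ?thesis
    using excess_nonneg[OF assms] g_cases[of "\<sigma> ` block k 0"] g_cases[of "\<sigma> ` block k 1"]
    by (auto simp: excess_def)
qed

text \<open>
Two members of \<open>G\<close> in one partition cause a surplus, so \<open>G\<close> is nearly intersecting.
\<close>

lemma disjoint_pairs_le: "avg \<Omega> (\<lambda>A. g A * disj_avg X k g A) \<le> \<tau>"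
proof -
  have "avg \<Omega> (\<lambda>A. g A * disj_avg X k g A) = avg P (\<lambda>\<sigma>. g (\<sigma> ` block k 0) * g (\<sigma> ` block k 1))"
    by (subst avg_P_blocks) (simp add: disj_avg_def avg_cmult)
  also have "\<dots> \<le> avg P excess" by (intro avg_mono two_blocks_le_excess)
  finally show ?thesis by (simp add: avg_excess)
qed

lemma real_card_X: "real (card X) = real s * real k"
  by (simp add: card_X)

lemma ratio_eq: "real k / (real (card X) - real k) = 1 / (real s - 1)"
proof -
  have "real (card X) - real k = real k * (real s - 1)" by (simp add: real_card_X algebra_simps)
  then show ?thesis using k by simp
qed

section \<open>The linear part of the family\<close>

definition linear :: "(nat \<Rightarrow> real) \<Rightarrow> nat set \<Rightarrow> real" where
  "linear c A = (\<Sum>y\<in>A. c y)"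

text \<open>
The orthogonal projection of \<open>g\<close> to the span of the stars.  Its coefficients are affine in the
degrees; the slope and the shift \<open>\<kappa>\<close> are found by comparing the means on each star.
\<close>

lemma ex_linear_part:
  "\<exists>c. star_free X k (\<lambda>A. g A - linear c A) \<and>
    (\<forall>a b. c a - c b = (real (card X) - 1) / (real (card X) - real k) * (\<mu> a - \<mu> b))"
proof -
  define n where "n = real (card X)"
  define r where "r = (n - 1) / (n - real k)"
  define M where "M = (\<Sum>x\<in>X. \<mu> x)"
  \<comment> \<open>solves \<open>\<kappa> * (n - k) = (k - 1) * C\<close>, in which the sum \<open>C\<close> of the coefficients depends on \<open>\<kappa>\<close>\<close>
  define \<kappa> where "\<kappa> = (real k - 1) * r * M / (real k * (n - 1))"
  define c where "c y = r * \<mu> y - \<kappa>" for y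
  have n: "n - real k > 0" "n - 1 > 0" using bounds k by (simp_all add: n_def)
  define C where "C = (\<Sum>y\<in>X. c y)"
  have "C = r * M - n * \<kappa>"
    by (simp add: C_def c_def sum_subtractf M_def n_def sum_distrib_left)
  moreover have "\<kappa> * (real k * (n - 1)) = (real k - 1) * r * M"
    using k n by (simp add: \<kappa>_def)
  ultimately have "\<kappa> * (real k * (n - 1)) = (real k - 1) * (C + n * \<kappa>)" by simp
  then have \<kappa>: "\<kappa> * (n - real k) = (real k - 1) * C"
    by (simp add: algebra_simps)
  have "star_free X k (\<lambda>A. g A - linear c A)"
    unfolding star_free_def
  proof
    fix x assume x: "x \<in> X"
    let ?Y = "X - {x}"
    obtain i where i: "k = Suc i" using k by (cases k) auto
    then have ki: "k - 1 = i" by simp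
    have cY: "card ?Y = card X - 1" using x by simp
    have ile: "i \<le> card ?Y" using bounds(2) i cY by linarith
    have fin: "finite (nsets ?Y i)" "nsets ?Y i \<noteq> {}"
    proof -
      show "finite (nsets ?Y i)" by (intro finite_imp_finite_nsets) simp
      show "nsets ?Y i \<noteq> {}" using ile unfolding nsets_eq_empty_iff by simp
    qed
    have "avg (nsets ?Y i) (\<lambda>S. linear c (insert x S)) = avg (nsets ?Y i) (\<lambda>S. c x + (\<Sum>y\<in>S. c y))"
      by (intro avg_cong) (auto simp: linear_def nsets_def intro!: sum.insert)
    also have "\<dots> = c x + real i / (n - 1) * (C - c x)"
    proof -
      have "avg (nsets ?Y i) (\<lambda>S. \<Sum>y\<in>S. c y) = real i / real (card ?Y) * (\<Sum>y\<in>?Y. c y)"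
        by (intro avg_nsets_sum_elements ile) simp
      moreover have "real (card ?Y) = n - 1" using bounds by (simp add: cY n_def of_nat_diff)
      moreover have "(\<Sum>y\<in>?Y. c y) = C - c x" using x by (simp add: C_def sum_diff1)
      ultimately show ?thesis by (simp only: avg_add avg_const[OF fin])
    qed
    also have "\<dots> = \<mu> x"
    proof -
      have "(n - 1) * (c x + real i / (n - 1) * (C - c x)) = (n - 1) * c x + real i * (C - c x)"
        using n by (simp add: distrib_left)
      also have "\<dots> = c x * (n - 1 - real i) + real i * C" by (simp add: algebra_simps)
      also have "\<dots> = c x * (n - real k) + \<kappa> * (n - real k)" unfolding \<kappa> by (simp add: i)
      also have "\<dots> = r * \<mu> x * (n - real k)" by (simp add: c_def algebra_simps)
      also have "\<dots> = (n - 1) * \<mu> x" using n by (simp add: r_def)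
      finally show ?thesis using n by simp
    qed
    finally have "avg (nsets ?Y i) (\<lambda>S. g (insert x S) - linear c (insert x S)) = 0"
      unfolding \<mu>_def ki avg_diff by simp
    then have "(\<Sum>S\<in>nsets ?Y i. g (insert x S) - linear c (insert x S)) = 0"
      using fin by (simp add: avg_def del: card_nsets)
    then show "(\<Sum>A\<in>nsets X k. if x \<in> A then g A - linear c A else 0) = 0"
      using sum_nsets_containing[OF finite_X x, where j = i and f = "\<lambda>A. g A - linear c A", folded i] by (simp only:)
  qed
  moreover have "c a - c b = r * (\<mu> a - \<mu> b)" for a b by (simp add: c_def algebra_simps)
  ultimately show ?thesis by (auto simp: r_def n_def)
qed

text \<open>
On linear functions with mean zero the Kneser operator is multiplication by \<open>- 1 / (s - 1)\<close>, its
smallest eigenvalue, and on the functions orthogonal to the stars it has norm at most half of that.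
As \<open>G\<close> is nearly intersecting and has density about \<open>1 / s\<close>, it nearly attains equality in the ratio
bound; so most of its variance belongs to the smallest eigenvalue.
\<close>

lemma residual_small:
  assumes c: "star_free X k (\<lambda>A. g A - linear c A)"
  shows "avg \<Omega> (\<lambda>A. (g A - linear c A)\<^sup>2) \<le> 2 * (real s - 1) * \<tau>"
proof -
  define f where "f A = g A - linear c A" for A
  define \<rho> where "\<rho> = avg \<Omega> (\<lambda>A. (f A)\<^sup>2)"
  define C where "C = (\<Sum>y\<in>X. c y)"
  let ?K = "disj_avg X k"
  have sf: "star_free X k f" using c by (simp add: f_def[abs_def])
  have ortho: "avg \<Omega> (\<lambda>A. linear d A * f A) = 0" for d
    using star_free_orthogonal_linear[OF finite_X sf, of d] by (simp add: avg_def linear_def \<Omega>_def)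
  have mean: "avg \<Omega> f = 0"
    using star_free_sum[OF finite_X sf] k by (simp add: avg_def \<Omega>_def)
  have gf: "g A = linear c A + f A" for A by (simp add: f_def)
  have s1: "real s - 1 > 0" using s by simp
  have Klin: "?K (linear c) A = (C - linear c A) / (real s - 1)" if A: "A \<in> \<Omega>" for A
  proof -
    have AX: "A \<subseteq> X" "finite A" "card A = k" using A by (auto simp: \<Omega>_def nsets_def)
    then have cc: "card (X - A) = card X - k" by (simp add: card_Diff_subset)
    have "?K (linear c) A = real k / real (card (X - A)) * (\<Sum>y\<in>X - A. c y)"
      unfolding disj_avg_def linear_def[abs_def] using bounds cc by (intro avg_nsets_sum_elements) auto
    also have "real (card (X - A)) = real (card X) - real k" using bounds by (simp add: cc of_nat_diff)
    also have "(\<Sum>y\<in>X - A. c y) = C - linear c A" using AX by (simp add: C_def linear_def sum_diff)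
    finally show ?thesis unfolding ratio_eq by simp
  qed
  have adj: "avg \<Omega> (\<lambda>A. u A * ?K v A) = avg \<Omega> (\<lambda>A. ?K u A * v A)" for u v
    unfolding \<Omega>_def by (rule disj_avg_adjoint) simp
  have Kadd: "?K g A = ?K (linear c) A + ?K f A" for A
    unfolding disj_avg_def gf avg_add ..
  have \<alpha>: "avg \<Omega> (linear c) = \<alpha>"
    unfolding \<alpha>_def gf avg_add mean by simp
  have "avg \<Omega> (linear c) = real k / real (card X) * C"
    unfolding C_def \<Omega>_def linear_def[abs_def] using bounds by (intro avg_nsets_sum_elements) auto
  then have C: "C = real s * \<alpha>" using k s by (simp add: \<alpha> real_card_X field_simps)
  have sq: "avg \<Omega> (\<lambda>A. (linear c A)\<^sup>2) = \<alpha> - \<rho>"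
  proof -
    have "\<alpha> = avg \<Omega> (\<lambda>A. (g A)\<^sup>2)" by (simp add: \<alpha>_def g_square)
    also have "\<dots> = avg \<Omega> (\<lambda>A. (linear c A)\<^sup>2 + 2 * (linear c A * f A) + (f A)\<^sup>2)"
      unfolding gf by (intro avg_cong) (simp add: power2_sum)
    also have "\<dots> = avg \<Omega> (\<lambda>A. (linear c A)\<^sup>2) + \<rho>"
      by (simp only: avg_add avg_cmult ortho \<rho>_def)
    finally show ?thesis by simp
  qed
  have "avg \<Omega> (\<lambda>A. linear c A * ?K (linear c) A) = avg \<Omega> (\<lambda>A. (C * linear c A - (linear c A)\<^sup>2) / (real s - 1))"
    by (intro avg_cong) (simp add: Klin power2_eq_square algebra_simps)
  also have "\<dots> = (C * \<alpha> - (\<alpha> - \<rho>)) / (real s - 1)"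
    by (simp only: avg_divide avg_diff avg_cmult \<alpha> sq)
  also have "\<dots> = (\<alpha> * \<tau> + \<rho>) / (real s - 1)" by (simp add: C \<tau>_def algebra_simps)
  finally have ll: "avg \<Omega> (\<lambda>A. linear c A * ?K (linear c) A) = (\<alpha> * \<tau> + \<rho>) / (real s - 1)" .
  have fl: "avg \<Omega> (\<lambda>A. f A * ?K (linear c) A) = 0"
  proof -
    have "avg \<Omega> (\<lambda>A. f A * ?K (linear c) A) = avg \<Omega> (\<lambda>A. (C * f A - linear c A * f A) / (real s - 1))"
      by (intro avg_cong) (simp add: Klin algebra_simps)
    also have "\<dots> = 0" by (simp only: avg_divide avg_diff avg_cmult mean ortho) simp
    finally show ?thesis .
  qed
  have lf: "avg \<Omega> (\<lambda>A. linear c A * ?K f A) = 0"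
  proof -
    have "avg \<Omega> (\<lambda>A. linear c A * ?K f A) = avg \<Omega> (\<lambda>A. ?K (linear c) A * f A)" by (rule adj)
    also have "\<dots> = avg \<Omega> (\<lambda>A. f A * ?K (linear c) A)" by (intro avg_cong mult.commute)
    finally show ?thesis using fl by simp
  qed
  have ff: "\<bar>avg \<Omega> (\<lambda>A. f A * ?K f A)\<bar> \<le> \<rho> / (2 * (real s - 1))"
  proof -
    let ?r = "real k * (real k - 1) / ((real (card X) - real k) * (real (card X) - real k - 1))"
    have "(real k - 1) / (real (card X) - real k - 1) \<le> 1 / 2"
    proof -
      have "3 * real k \<le> real (card X)" using bounds(1) unfolding card_X by (metis of_nat_le_iff of_nat_mult of_nat_numeral)
      then show ?thesis using k by (simp add: divide_le_eq)
    qed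
    then have "(1 / (real s - 1)) * ((real k - 1) / (real (card X) - real k - 1)) \<le> (1 / (real s - 1)) * (1 / 2)"
      using s1 by (intro mult_left_mono) auto
    moreover have "?r = (1 / (real s - 1)) * ((real k - 1) / (real (card X) - real k - 1))"
      unfolding ratio_eq[symmetric] by simp
    moreover have "(1 / (real s - 1)) * (1 / 2) = 1 / (2 * (real s - 1))" by simp
    ultimately have "?r \<le> 1 / (2 * (real s - 1))" by (simp only:)
    moreover have "\<rho> \<ge> 0" unfolding \<rho>_def by (intro avg_nonneg) simp
    ultimately have "?r * \<rho> \<le> 1 / (2 * (real s - 1)) * \<rho>" by (rule mult_right_mono)
    then show ?thesis
      using kneser_form_star_free[OF finite_X bounds(2) _ sf] k by (simp add: \<rho>_def \<Omega>_def)
  qed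
  have "avg \<Omega> (\<lambda>A. g A * ?K g A) =
      avg \<Omega> (\<lambda>A. linear c A * ?K (linear c) A + linear c A * ?K f A + (f A * ?K (linear c) A + f A * ?K f A))"
    by (intro avg_cong) (simp add: Kadd, simp add: gf algebra_simps)
  also have "\<dots> = (\<alpha> * \<tau> + \<rho>) / (real s - 1) + avg \<Omega> (\<lambda>A. f A * ?K f A)"
    by (simp only: avg_add ll lf fl)
  finally have "(\<alpha> * \<tau> + \<rho>) / (real s - 1) + avg \<Omega> (\<lambda>A. f A * ?K f A) \<le> \<tau>"
    using disjoint_pairs_le by simp
  moreover have "\<alpha> * \<tau> \<ge> 0" using \<tau>_nonneg unfolding \<alpha>_def by (simp add: avg_nonneg g_nonneg)
  then have "(\<alpha> * \<tau> + \<rho>) / (real s - 1) \<ge> \<rho> / (real s - 1)" using s1 by (simp add: divide_right_mono)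
  ultimately have "\<rho> / (real s - 1) - \<rho> / (2 * (real s - 1)) \<le> \<tau>" using ff by linarith
  also have "\<rho> / (real s - 1) - \<rho> / (2 * (real s - 1)) = \<rho> / (2 * (real s - 1))"
  proof -
    have half: "u - u / 2 = u / 2" for u :: real by simp
    have "\<rho> / (2 * (real s - 1)) = \<rho> / (real s - 1) / 2" by (simp only: divide_divide_eq_left mult.commute)
    then show ?thesis by (simp only: half)
  qed
  finally show ?thesis using s1 by (simp add: field_simps \<rho>_def f_def)
qed

section \<open>An element of large degree\<close>

lemma \<mu>_bounds: "0 \<le> \<mu> x" "\<mu> x \<le> 1"
proof -
  show "0 \<le> \<mu> x" unfolding \<mu>_def by (intro avg_nonneg g_nonneg)
  have "\<bar>\<mu> x\<bar> \<le> 1" unfolding \<mu>_def using g_cases by (intro abs_avg_le) (metis abs_0 abs_1 order_refl zero_le_one, simp)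
  then show "\<mu> x \<le> 1" by simp
qed

text \<open>
In a random partition the first two blocks are matched element by element, and matched elements are
exchanged by independent coin flips.  The difference of the linear parts of the two blocks is then a
Rademacher sum whose weights are differences of coefficients.  It is close to the difference of the
two values of \<open>g\<close>, whose modulus is 1 if exactly one of the two blocks is in \<open>G\<close>.  Unless there is a
surplus, this happens exactly if no other block is in \<open>G\<close>, which does not depend on the flips.  So
\<open>rademacher_dominant_weight\<close> applies: if no weight were close to 1, then nearly never exactly
one of the two blocks could be in \<open>G\<close>, whereas this has probability about \<open>2 / s\<close>.
\<close>

lemma ex_large_coefficient_gap:
  assumes c: "star_free X k (\<lambda>A. g A - linear c A)" and small: "(real s)\<^sup>2 * \<tau> \<le> 1 / 10 ^ 6"
  shows "\<exists>a\<in>X. \<exists>b\<in>X. \<bar>c a - c b\<bar> > 95 / 100"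
proof (rule ccontr)
  assume "\<not> ?thesis"
  then have gap: "\<bar>c a - c b\<bar> \<le> 95 / 100" if "a \<in> X" "b \<in> X" for a b using that by force
  let ?I = "block k 0" and ?J = "block k 1" and ?L = "{1..k}"
  define f where "f A = g A - linear c A" for A
  define a where "a \<sigma> = \<bar>g (\<sigma> ` ?I) - g (\<sigma> ` ?J)\<bar>" for \<sigma> :: "nat \<Rightarrow> nat"
  define e where "e \<sigma> = (f (\<sigma> ` ?I) - f (\<sigma> ` ?J))\<^sup>2" for \<sigma> :: "nat \<Rightarrow> nat"
  have flipX: "pair_flip k t permutes X" for t
    unfolding X_def using bounds(3) by (intro pair_flip_permutes) (simp add: card_X)
  have flipP: "\<sigma> \<circ> pair_flip k t \<in> P" if "\<sigma> \<in> P" for \<sigma> t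
    using that flipX permutes_compose[OF flipX] by (auto simp: P_def)
  have a01: "a \<sigma> = 0 \<or> a \<sigma> = 1" for \<sigma>
    using g_cases[of "\<sigma> ` ?I"] g_cases[of "\<sigma> ` ?J"] by (auto simp: a_def)
  have L: "finite ?L" "?L \<noteq> {}" using k by auto
  have finL: "finite (Pow ?L)" "Pow ?L \<noteq> {}" by auto
  \<comment> \<open>the weights miss the value 1 by at least \<open>0.05\<close>, whose square is \<open>25 / 10000\<close>\<close>
  have pointwise: "25 / 10000 * avg (Pow ?L) (\<lambda>t. a (\<sigma> \<circ> pair_flip k t)) \<le>
      56 * avg (Pow ?L) (\<lambda>t. e (\<sigma> \<circ> pair_flip k t) + excess (\<sigma> \<circ> pair_flip k t))"
    if \<sigma>: "\<sigma> \<in> P" for \<sigma>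
  proof -
    define w where "w i = c (\<sigma> i) - c (\<sigma> (i + k))" for i
    define \<sigma>' where "\<sigma>' t = \<sigma> \<circ> pair_flip k t" for t
    have \<sigma>'P: "\<sigma>' t \<in> P" for t unfolding \<sigma>'_def using \<sigma> by (rule flipP)
    have inj: "inj (\<sigma>' t)" for t using \<sigma>'P[of t] permutes_inj unfolding P_def by blast
    have Z: "linear c (\<sigma>' t ` ?I) - linear c (\<sigma>' t ` ?J) = signed_sum ?L w t" for t
    proof -
      have I: "linear c (\<sigma>' t ` ?I) = (\<Sum>i\<in>?L. c (\<sigma>' t i))"
        unfolding linear_def using inj[of t] by (subst sum.reindex) (auto simp: block_def inj_on_def inj_def)
      have "?J = (\<lambda>i. i + k) ` ?L" by (auto simp: block_def image_iff intro: bexI[of _ "_ - k"])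
      then have J: "linear c (\<sigma>' t ` ?J) = (\<Sum>i\<in>?L. c (\<sigma>' t (i + k)))"
        unfolding linear_def
        by (simp only: image_image, subst sum.reindex) (auto intro!: inj_onI dest!: injD[OF inj])
      show ?thesis
        unfolding I J signed_sum_def sum_subtractf[symmetric]
        by (intro sum.cong refl) (auto simp: \<sigma>'_def pair_flip_def w_def)
    qed
    have "\<exists>i\<in>?L. avg (Pow ?L) (\<lambda>t. (\<bar>w i\<bar> - a (\<sigma>' t))\<^sup>2) \<le> 56 * avg (Pow ?L) (\<lambda>t. e (\<sigma>' t) + excess (\<sigma>' t))"
    proof (rule rademacher_dominant_weight[OF L])
      fix t assume "t \<subseteq> ?L"
      have "\<bar>\<bar>signed_sum ?L w t\<bar> - a (\<sigma>' t)\<bar> \<le> \<bar>f (\<sigma>' t ` ?I) - f (\<sigma>' t ` ?J)\<bar>"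
        unfolding Z[symmetric] a_def f_def by linarith
      then show "(\<bar>signed_sum ?L w t\<bar> - a (\<sigma>' t))\<^sup>2 \<le> e (\<sigma>' t)"
        by (simp add: e_def abs_le_square_iff)
    next
      fix t t' assume "t \<subseteq> ?L" "t' \<subseteq> ?L"
      show "(a (\<sigma>' t) - a (\<sigma>' t'))\<^sup>2 \<le> excess (\<sigma>' t) + excess (\<sigma>' t')"
      proof (cases "excess (\<sigma>' t) = 0 \<and> excess (\<sigma>' t') = 0")
        case True
        \<comment> \<open>without surplus, the first two blocks contain a member exactly if the others do not\<close>
        have exact: "a (\<sigma>' t) = 1 - (\<Sum>j=2..<s. g (\<sigma> ` block k j))" if "excess (\<sigma>' t) = 0" for t
        proof -
          have "{..<s} = {0, 1} \<union> {2..<s}" using s by auto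
          then have "excess (\<sigma>' t) = g (\<sigma>' t ` ?I) + g (\<sigma>' t ` ?J) + (\<Sum>j=2..<s. g (\<sigma>' t ` block k j)) - 1"
            by (simp add: excess_def sum.union_disjoint)
          also have "(\<Sum>j=2..<s. g (\<sigma>' t ` block k j)) = (\<Sum>j=2..<s. g (\<sigma> ` block k j))"
          proof (intro sum.cong refl arg_cong[of _ _ g])
            fix j assume "j \<in> {2..<s}"
            then have jk: "2 * k \<le> j * k" by (intro mult_le_mono1) simp
            have "pair_flip k t y = y" if "y \<in> block k j" for y
            proof -
              have "2 * k < y" using that jk unfolding block_def atLeastAtMost_iff by linarith
              then show ?thesis by (simp add: pair_flip_def)
            qed
            then show "\<sigma>' t ` block k j = \<sigma> ` block k j"
              by (simp add: \<sigma>'_def cong: image_cong)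
          qed
          finally have sum1: "g (\<sigma>' t ` ?I) + g (\<sigma>' t ` ?J) + (\<Sum>j=2..<s. g (\<sigma> ` block k j)) = 1"
            using that by simp
          have "(\<Sum>j=2..<s. g (\<sigma> ` block k j)) \<ge> 0" by (intro sum_nonneg g_nonneg)
          then show ?thesis
            using sum1 g_cases[of "\<sigma>' t ` ?I"] g_cases[of "\<sigma>' t ` ?J"] by (auto simp: a_def)
        qed
        then show ?thesis using True by simp
      next
        case False
        then have "1 \<le> excess (\<sigma>' t) + excess (\<sigma>' t')"
          using excess_cases[OF \<sigma>'P[of t]] excess_cases[OF \<sigma>'P[of t']] by linarith
        moreover have "(a (\<sigma>' t) - a (\<sigma>' t'))\<^sup>2 \<le> 1"
          using a01[of "\<sigma>' t"] a01[of "\<sigma>' t'"] by auto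
        ultimately show ?thesis by linarith
      qed
    qed
    then obtain i where i: "i \<in> ?L"
      "avg (Pow ?L) (\<lambda>t. (\<bar>w i\<bar> - a (\<sigma>' t))\<^sup>2) \<le> 56 * avg (Pow ?L) (\<lambda>t. e (\<sigma>' t) + excess (\<sigma>' t))" by blast
    have "1 \<le> i" "i \<le> k" using i(1) by simp_all
    then have "i \<in> X" "i + k \<in> X"
      using bounds(3) unfolding card_X unfolding X_def atLeastAtMost_iff by linarith+
    then have w: "\<bar>w i\<bar> \<le> 95 / 100"
      unfolding w_def using \<sigma> by (intro gap) (auto simp: P_def permutes_in_image)
    have "25 / 10000 * a (\<sigma>' t) \<le> (\<bar>w i\<bar> - a (\<sigma>' t))\<^sup>2" for t
    proof (cases "a (\<sigma>' t) = 0")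
      case False
      then have a1: "a (\<sigma>' t) = 1" using a01 by blast
      have "(5 / 100)\<^sup>2 \<le> (1 - \<bar>w i\<bar>)\<^sup>2" using w by (intro power_mono) auto
      also have "\<dots> = (\<bar>w i\<bar> - 1)\<^sup>2" by (rule power2_commute)
      finally show ?thesis by (simp add: a1 power_divide)
    qed simp
    then have "avg (Pow ?L) (\<lambda>t. 25 / 10000 * a (\<sigma>' t)) \<le> avg (Pow ?L) (\<lambda>t. (\<bar>w i\<bar> - a (\<sigma>' t))\<^sup>2)"
      by (rule avg_mono)
    then show ?thesis using i(2) unfolding avg_cmult \<sigma>'_def by linarith
  qed
  \<comment> \<open>a uniformly random permutation stays uniformly random after any flip\<close>
  have inv: "avg P (\<lambda>\<sigma>. avg (Pow ?L) (\<lambda>t. \<psi> (\<sigma> \<circ> pair_flip k t))) = avg P \<psi>" for \<psi> :: "(nat \<Rightarrow> nat) \<Rightarrow> real"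
  proof -
    have "avg P (\<lambda>\<sigma>. avg (Pow ?L) (\<lambda>t. \<psi> (\<sigma> \<circ> pair_flip k t))) =
        avg (Pow ?L) (\<lambda>t. avg P (\<lambda>\<sigma>. \<psi> (\<sigma> \<circ> pair_flip k t)))" by (rule avg_swap)
    also have "\<dots> = avg (Pow ?L) (\<lambda>_. avg P \<psi>)" by (simp only: avg_P_compose[OF flipX])
    finally show ?thesis using avg_const[OF finL] by simp
  qed
  have "avg P (\<lambda>\<sigma>. 25 / 10000 * avg (Pow ?L) (\<lambda>t. a (\<sigma> \<circ> pair_flip k t))) \<le>
      avg P (\<lambda>\<sigma>. 56 * avg (Pow ?L) (\<lambda>t. e (\<sigma> \<circ> pair_flip k t) + excess (\<sigma> \<circ> pair_flip k t)))"
    by (intro avg_mono pointwise)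
  then have main: "25 / 10000 * avg P a \<le> 56 * (avg P e + \<tau>)"
    unfolding avg_cmult avg_add inv[of a] inv[of e] inv[of excess] avg_excess .
  have s0: "0 < s" "1 < s" using s by auto
  have Ea: "avg P a \<ge> 2 * \<alpha> - 2 * \<tau>"
  proof -
    have "2 * \<alpha> - 2 * \<tau> = avg P (\<lambda>\<sigma>. g (\<sigma> ` ?I) + g (\<sigma> ` ?J) - 2 * excess \<sigma>)"
      by (simp only: avg_diff avg_add avg_cmult avg_excess avg_P_block[OF s0(1)] avg_P_block[OF s0(2)] \<alpha>_def)
    also have "\<dots> \<le> avg P a"
    proof (rule avg_mono)
      fix \<sigma> assume "\<sigma> \<in> P"
      then show "g (\<sigma> ` ?I) + g (\<sigma> ` ?J) - 2 * excess \<sigma> \<le> a \<sigma>"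
        using two_blocks_le_excess[of \<sigma>] excess_nonneg[of \<sigma>] g_cases[of "\<sigma> ` ?I"] g_cases[of "\<sigma> ` ?J"]
        by (auto simp: a_def)
    qed
    finally show ?thesis .
  qed
  have Ee: "avg P e \<le> 8 * (real s - 1) * \<tau>"
  proof -
    have "avg P e \<le> avg P (\<lambda>\<sigma>. 2 * (f (\<sigma> ` ?I))\<^sup>2 + 2 * (f (\<sigma> ` ?J))\<^sup>2)"
    proof (rule avg_mono)
      fix \<sigma>
      show "e \<sigma> \<le> 2 * (f (\<sigma> ` ?I))\<^sup>2 + 2 * (f (\<sigma> ` ?J))\<^sup>2"
        using square_sum2_le[of "f (\<sigma> ` ?I)" "- f (\<sigma> ` ?J)"] by (simp add: e_def)
    qed
    also have "\<dots> = 4 * avg \<Omega> (\<lambda>A. (f A)\<^sup>2)"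
      using avg_P_block[OF s0(1), of "\<lambda>A. (f A)\<^sup>2"] avg_P_block[OF s0(2), of "\<lambda>A. (f A)\<^sup>2"]
      by (simp only: avg_add avg_cmult)
    also have "\<dots> \<le> 8 * (real s - 1) * \<tau>"
      using mult_left_mono[OF residual_small[OF c], of 4] by (simp add: f_def algebra_simps)
    finally show ?thesis .
  qed
  have "25 / 10000 * (2 * \<alpha> - 2 * \<tau>) \<le> 25 / 10000 * avg P a"
    by (intro mult_left_mono Ea) simp
  also note main
  also have "56 * (avg P e + \<tau>) \<le> 56 * (8 * (real s - 1) * \<tau> + \<tau>)"
    by (intro mult_left_mono add_right_mono Ee) simp
  finally have "real s * (25 / 10000 * (2 * \<alpha> - 2 * \<tau>)) \<le> real s * (56 * (8 * (real s - 1) * \<tau> + \<tau>))"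
    by (intro mult_left_mono) auto
  moreover have "real s * (25 / 10000 * (2 * \<alpha> - 2 * \<tau>)) = 25 / 10000 * (2 + 2 * \<tau> - 2 * (real s * \<tau>))"
    by (simp add: \<tau>_def algebra_simps)
  moreover have "real s * (56 * (8 * (real s - 1) * \<tau> + \<tau>)) = 448 * ((real s)\<^sup>2 * \<tau>) - 392 * (real s * \<tau>)"
    by (simp add: power2_eq_square algebra_simps)
  ultimately have le: "25 / 10000 * (2 + 2 * \<tau> - 2 * (real s * \<tau>)) \<le>
      448 * ((real s)\<^sup>2 * \<tau>) - 392 * (real s * \<tau>)" by (simp only:)
  have contra: False
    if "25 / 10000 * (2 + 2 * t - 2 * u) \<le> 448 * v - 392 * u" "0 \<le> t" "0 \<le> u" "v \<le> 1 / 1000000" for t u v :: real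
    using that unfolding right_diff_distrib distrib_left by linarith
  show False
    using contra[OF le \<tau>_nonneg] small \<tau>_nonneg by simp
qed

text \<open>
Two coefficients that differ by more than \<open>0.95\<close> belong to degrees that differ by more than
\<open>0.95 * 2 / 3\<close>, and no degree is negative.
\<close>

lemma ex_large_degree:
  assumes small: "(real s)\<^sup>2 * \<tau> \<le> 1 / 10 ^ 6"
  shows "\<exists>x\<in>X. \<mu> x \<ge> 63 / 100"
proof -
  let ?q = "(real (card X) - 1) / (real (card X) - real k)"
  obtain c where c: "star_free X k (\<lambda>A. g A - linear c A)"
    and diff: "\<And>a b. c a - c b = ?q * (\<mu> a - \<mu> b)" using ex_linear_part by blast
  obtain a b where ab: "a \<in> X" "b \<in> X" "\<bar>c a - c b\<bar> > 95 / 100"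
    using ex_large_coefficient_gap[OF c small] by blast
  have q: "0 < ?q" "?q \<le> 3 / 2"
  proof -
    have "3 * real k \<le> real (card X)" using bounds(1) unfolding card_X by (metis of_nat_le_iff of_nat_mult of_nat_numeral)
    moreover have "1 \<le> real k" using k by simp
    ultimately show "0 < ?q" "?q \<le> 3 / 2" by (simp_all add: divide_le_eq)
  qed
  have "95 / 100 < ?q * \<bar>\<mu> a - \<mu> b\<bar>" using ab(3) q(1) by (simp only: diff abs_mult abs_of_pos)
  also have "\<dots> \<le> 3 / 2 * \<bar>\<mu> a - \<mu> b\<bar>" using q by (intro mult_right_mono) auto
  finally have "\<bar>\<mu> a - \<mu> b\<bar> > 63 / 100" by simp
  then have "\<mu> a > 63 / 100 \<or> \<mu> b > 63 / 100" using \<mu>_bounds(1)[of a] \<mu>_bounds(1)[of b] by linarith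
  then show ?thesis using ab by force
qed

section \<open>From large degree to nearly full degree\<close>

text \<open>
Let \<open>z\<close> be the deficiency \<open>1 - \<mu> x\<close> and \<open>\<beta>\<close> the density of \<open>G\<close> among the \<open>k\<close>-sets avoiding \<open>x\<close>.  As the
total density is at least \<open>1 / s\<close>, the deficiency is compensated: \<open>(s - 1) * \<beta> \<ge> z\<close>.  By the
mean-square bound on the Kneser operator between the \<open>(k - 1)\<close>-sets and the \<open>k\<close>-sets of the remaining
points, for a typical \<open>k\<close>-set avoiding \<open>x\<close> about a fraction \<open>\<mu> x\<close> of the \<open>k\<close>-sets that contain \<open>x\<close> and
are disjoint from it belong to \<open>G\<close>.  For the members of \<open>G\<close> that avoid \<open>x\<close> this fraction is small on
average, because \<open>G\<close> is nearly intersecting; so \<open>\<beta>\<close> is small.  Comparing both bounds leaves only \<open>z\<close> of the order of \<open>s\<^sup>2 * \<tau>\<close>;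
the comparison needs \<open>\<mu> x\<close> to exceed \<open>1 / (s - 1)\<close>, which is at most \<open>1 / 2\<close>.
\<close>

lemma large_degree_nearly_full:
  assumes x: "x \<in> X" and large: "\<mu> x \<ge> 63 / 100"
  shows "1 - \<mu> x \<le> 100 * (real s)\<^sup>2 * \<tau>"
proof (rule ccontr)
  assume neg: "\<not> ?thesis"
  define z where "z = 1 - \<mu> x"
  define d where "d = real s - 1"
  define Y where "Y = X - {x}"
  define h where "h S = g (insert x S)" for S
  define \<beta> where "\<beta> = avg (nsets Y k) g"
  define n where "n = real (card X)"
  obtain i where i: "k = Suc i" using k by (cases k) auto
  then have ki: "k - 1 = i" and ri: "real i = real k - 1" by simp_all
  have z: "100 * (real s)\<^sup>2 * \<tau> < z" using neg by (simp add: z_def)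
  have d: "2 \<le> d" "real s = d + 1" using s by (simp_all add: d_def)
  have n: "n = real s * real k" by (simp add: n_def real_card_X)
  have finY: "finite Y" by (simp add: Y_def)
  have cY: "card Y = card X - 1" using x by (simp add: Y_def)
  have cY': "real (card Y) = n - 1" using bounds by (simp add: cY n_def of_nat_diff)
  have \<mu>: "\<mu> x = avg (nsets Y i) h" unfolding \<mu>_def ki Y_def h_def ..
  have nk: "n - real k = d * real k" by (simp add: n d algebra_simps)
  have kpos: "0 < real k" using k by simp
  have ik: "i + k < card Y" using bounds(3) cY i by linarith
  obtain N where N: "card X = Suc N" using bounds by (cases "card X") auto
  then have YN: "card Y = N" using cY by simp
  have finYk: "finite (nsets Y k)" "nsets Y k \<noteq> {}" and finYi: "finite (nsets Y i)" "nsets Y i \<noteq> {}"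
    using finite_imp_finite_nsets[OF finY] ik unfolding nsets_eq_empty_iff by auto
  have bin: "real (card (nsets Y k)) * n = real (card \<Omega>) * (n - real k)"
    "real (card (nsets Y i)) * n = real (card \<Omega>) * real k"
  proof -
    have 1: "real k * real (Suc N choose k) = real (Suc N) * real (N choose i)"
      using Suc_times_binomial[of i N, folded i] by (metis of_nat_mult)
    have c\<Omega>: "card \<Omega> = Suc N choose k" by (simp only: \<Omega>_def card_nsets N)
    have ci: "card (nsets Y i) = N choose i" and ck: "card (nsets Y k) = N choose k"
      by (simp_all only: card_nsets YN)
    show 2: "real (card (nsets Y i)) * n = real (card \<Omega>) * real k"
      using 1 unfolding ci c\<Omega> n_def N by (simp only: mult.commute)
    have "real (card \<Omega>) = real (card (nsets Y i)) + real (card (nsets Y k))"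
      unfolding ci ck c\<Omega> using binomial_Suc_Suc[of N i, folded i] by simp
    then show "real (card (nsets Y k)) * n = real (card \<Omega>) * (n - real k)"
      using 2 by (simp add: algebra_simps)
  qed
  have c\<Omega>: "real (card \<Omega>) > 0" using fin\<Omega> by (simp add: card_gt_0_iff)
  have npos: "n > 0" using n s kpos by simp
  have wk: "real (card (nsets Y k)) / real (card \<Omega>) = d / real s"
    and wi: "real (card (nsets Y i)) / real (card \<Omega>) = 1 / real s"
  proof -
    have "real (card (nsets Y k)) / real (card \<Omega>) = (n - real k) / n"
      using bin(1) c\<Omega> npos by (subst frac_eq_eq) (auto simp: mult.commute)
    then show "real (card (nsets Y k)) / real (card \<Omega>) = d / real s" unfolding nk using kpos by (simp add: n)
    have "real (card (nsets Y i)) / real (card \<Omega>) = real k / n"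
      using bin(2) c\<Omega> npos by (subst frac_eq_eq) (auto simp: mult.commute)
    then show "real (card (nsets Y i)) / real (card \<Omega>) = 1 / real s" unfolding n using kpos by simp
  qed
  have sums: "(\<Sum>B\<in>nsets Y k. u B) / real (card \<Omega>) = d / real s * avg (nsets Y k) u"
    "(\<Sum>S\<in>nsets Y i. u S) / real (card \<Omega>) = 1 / real s * avg (nsets Y i) u" for u
    unfolding wk[symmetric] wi[symmetric] avg_def using finYk finYi by (simp_all del: card_nsets)
  have "\<alpha> = d / real s * \<beta> + 1 / real s * \<mu> x"
  proof -
    have "(\<Sum>A\<in>\<Omega>. g A) = (\<Sum>B\<in>nsets Y k. g B) + (\<Sum>S\<in>nsets Y i. h S)"
      unfolding \<Omega>_def Y_def h_def using sum_nsets_Suc[OF finite_X x, where j = i and f = g, folded i] .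
    then show ?thesis
      unfolding \<alpha>_def avg_def[of \<Omega>] by (simp only: add_divide_distrib sums \<beta>_def \<mu>)
  qed
  then have \<beta>: "d * \<beta> = z + \<tau>" using s by (simp add: \<tau>_def z_def field_simps)
  define N where "N = disj_avg Y i h"
  define h' where "h' S = h S - \<mu> x" for S
  define e where "e = avg (nsets Y k) (\<lambda>B. g B * N B)"
  have e: "e \<le> real s * \<tau>"
  proof -
    define u where "u A = (if x \<in> A then g A else 0)" for A
    \<comment> \<open>a set disjoint from \<open>B\<close> that contains \<open>x\<close> is \<open>x\<close> together with a set avoiding \<open>x\<close> and \<open>B\<close>\<close>
    have Ku: "disj_avg X k u B = (if x \<in> B then 0 else 1 / d * N B)" if B: "B \<in> \<Omega>" for B
    proof (cases "x \<in> B")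
      case True
      then have "disj_avg X k u B = avg (nsets (X - B) k) (\<lambda>_. 0)"
        unfolding disj_avg_def by (intro avg_cong) (auto simp: u_def nsets_def)
      then show ?thesis using True by (simp add: avg_def)
    next
      case False
      let ?M = "card X - k"
      have cM: "card (X - B) = ?M" using B by (auto simp: \<Omega>_def nsets_def card_Diff_subset)
      have eq: "X - B - {x} = Y - B" by (auto simp: Y_def)
      have sum: "(\<Sum>A\<in>nsets (X - B) k. u A) = (\<Sum>S\<in>nsets (Y - B) i. h S)"
        unfolding u_def h_def eq[symmetric]
        using sum_nsets_containing[where X = "X - B" and x = x and j = i and f = g, folded i] False x by simp
      obtain m where m: "?M = Suc m" using bounds by (cases ?M) auto
      have "card (Y - B) = m" using cM m False x unfolding eq[symmetric] by (simp add: card_Diff_singleton)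
      then have c1: "card (nsets (Y - B) i) = m choose i" by simp
      have c2: "card (nsets (X - B) k) = Suc m choose k" by (simp only: card_nsets cM m)
      have 1: "real k * real (Suc m choose k) = real (Suc m) * real (m choose i)"
        using Suc_times_binomial[of i m, folded i] by (metis of_nat_mult)
      have "real (Suc m) = d * real k" using m bounds nk unfolding n_def by linarith
      then have "real k * real (Suc m choose k) = real k * (d * real (m choose i))"
        using 1 by (simp only: mult_ac)
      then have 2: "real (Suc m choose k) = d * real (m choose i)"
        using kpos by (simp only: mult_cancel_left) simp
      show ?thesis
        unfolding disj_avg_def avg_def N_def sum c1 c2 2 using False by simp
    qed
    have "avg \<Omega> (\<lambda>A. u A * disj_avg X k g A) \<le> avg \<Omega> (\<lambda>A. g A * disj_avg X k g A)"
      unfolding disj_avg_def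
      by (intro avg_mono mult_right_mono avg_nonneg) (auto simp: u_def g_nonneg)
    then have "avg \<Omega> (\<lambda>A. u A * disj_avg X k g A) \<le> \<tau>" using disjoint_pairs_le by linarith
    also have "avg \<Omega> (\<lambda>A. u A * disj_avg X k g A) = avg \<Omega> (\<lambda>B. disj_avg X k u B * g B)"
      unfolding \<Omega>_def by (rule disj_avg_adjoint) simp
    also have "\<dots> = avg \<Omega> (\<lambda>B. if x \<in> B then 0 else 1 / d * (g B * N B))"
      by (intro avg_cong) (simp add: Ku)
    also have "\<dots> = (\<Sum>B\<in>nsets Y k. 1 / d * (g B * N B)) / real (card \<Omega>)"
    proof -
      have "(\<Sum>B\<in>\<Omega>. if x \<in> B then 0 else 1 / d * (g B * N B)) =
          (\<Sum>B\<in>nsets Y k. if x \<in> B then 0 else 1 / d * (g B * N B))"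
        unfolding \<Omega>_def Y_def
        by (subst sum_nsets_Suc[OF finite_X x, where j = i, folded i]) simp
      also have "\<dots> = (\<Sum>B\<in>nsets Y k. 1 / d * (g B * N B))"
        by (intro sum.cong refl) (auto simp: Y_def nsets_def)
      finally show ?thesis by (simp add: avg_def)
    qed
    also have "\<dots> = 1 / real s * e"
      unfolding sums avg_cmult e_def using d by simp
    finally show ?thesis using s by (simp add: field_simps)
  qed
  have mean: "avg (nsets Y i) h' = 0"
    unfolding h'_def by (simp add: avg_diff avg_const[OF finYi] \<mu>)
  have var: "avg (nsets Y i) (\<lambda>S. (h' S)\<^sup>2) = \<mu> x * z"
  proof -
    have "avg (nsets Y i) (\<lambda>S. (h' S)\<^sup>2) = avg (nsets Y i) (\<lambda>S. h S - 2 * \<mu> x * h S + (\<mu> x)\<^sup>2)"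
      by (intro avg_cong) (simp add: h'_def h_def power2_diff g_square)
    also have "\<dots> = \<mu> x * z"
      by (simp only: avg_add avg_diff avg_cmult avg_const[OF finYi] \<mu>[symmetric])
         (simp add: z_def power2_eq_square algebra_simps)
    finally show ?thesis .
  qed
  have Nh: "disj_avg Y i h' B = N B - \<mu> x" if "B \<in> nsets Y k" for B
  proof -
    have "disj_avg Y i (\<lambda>_. \<mu> x) B = \<mu> x"
      using that ik by (intro disj_avg_const[OF finY]) auto
    then show ?thesis unfolding N_def h'_def disj_avg_def avg_diff by simp
  qed
  have norm: "avg (nsets Y k) (\<lambda>B. (N B - \<mu> x)\<^sup>2) \<le> \<mu> x * z / d\<^sup>2"
  proof -
    let ?r = "real i * real k / ((real (card Y) - real i) * (real (card Y) - real k))"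
    have "avg (nsets Y k) (\<lambda>B. (N B - \<mu> x)\<^sup>2) = avg (nsets Y k) (\<lambda>B. (disj_avg Y i h' B)\<^sup>2)"
      by (intro avg_cong) (simp add: Nh)
    also have "\<dots> \<le> ?r * avg (nsets Y i) (\<lambda>S. (h' S)\<^sup>2)"
      using mean finYi ik
      by (intro disj_avg_norm_mean_zero[OF finY]) (simp_all add: avg_def del: card_nsets)
    also have "\<dots> \<le> 1 / d\<^sup>2 * (\<mu> x * z)"
      unfolding var
    proof (rule mult_right_mono)
      have 1: "real (card Y) - real i = d * real k" using nk by (simp add: cY' ri)
      have 2: "real (card Y) - real k = d * real k - 1" using nk by (simp add: cY')
      have "1 * 2 \<le> real k * d" using k d by (intro mult_mono) auto
      then have pos: "0 < d * real k - 1" by (simp add: mult.commute)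
      have "?r = 1 / d * (real i / (d * real k - 1))"
        unfolding 1 2 using kpos by simp
      also have "real i / (d * real k - 1) \<le> 1 / d"
        using pos d by (simp add: divide_le_eq ri algebra_simps)
      finally show "?r \<le> 1 / d\<^sup>2" using d by (simp add: power2_eq_square divide_right_mono)
      show "0 \<le> \<mu> x * z" using \<mu>_bounds[of x] by (simp add: z_def)
    qed
    finally show ?thesis by simp
  qed
  \<comment> \<open>Chebyshev's inequality on the members of \<open>G\<close> that avoid \<open>x\<close>\<close>
  have CS: "(e - \<mu> x * \<beta>)\<^sup>2 \<le> \<beta> * (\<mu> x * z / d\<^sup>2)"
  proof -
    have "e - \<mu> x * \<beta> = avg (nsets Y k) (\<lambda>B. g B * (N B - \<mu> x))"
      unfolding e_def \<beta>_def right_diff_distrib avg_diff using avg_cmult[of "nsets Y k" "\<mu> x" g]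
      by (simp add: mult.commute)
    also have "(\<dots>)\<^sup>2 \<le> avg (nsets Y k) (\<lambda>B. (g B)\<^sup>2) * avg (nsets Y k) (\<lambda>B. (N B - \<mu> x)\<^sup>2)"
      by (rule avg_Cauchy_Schwarz)
    also have "\<dots> \<le> \<beta> * (\<mu> x * z / d\<^sup>2)"
      unfolding g_square \<beta>_def[symmetric] using norm
      by (intro mult_left_mono) (simp_all add: \<beta>_def avg_nonneg g_nonneg)
    finally show ?thesis .
  qed
  have zpos: "0 < z"
    using z \<tau>_nonneg by (smt (verit) mult_nonneg_nonneg zero_le_power2)
  have \<beta>z: "z \<le> d * \<beta>" using \<beta> \<tau>_nonneg by simp
  have \<beta>pos: "0 < \<beta>" using zpos \<beta>z d by (smt (verit) mult_nonneg_nonpos)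
  have "e \<le> \<beta> / 100"
  proof -
    have "100 * real s * (real s * \<tau>) < z" using z by (simp add: power2_eq_square mult_ac)
    then have "100 * real s * (real s * \<tau>) \<le> real s * \<beta>"
      using \<beta>z \<beta>pos d by (simp add: algebra_simps)
    then have "100 * (real s * \<tau>) \<le> \<beta>" using s by (simp add: mult.assoc mult.left_commute)
    then show ?thesis using e by simp
  qed
  then have "\<beta> * (\<mu> x - 1 / 100) \<le> \<mu> x * \<beta> - e" by (simp add: algebra_simps)
  moreover have "0 \<le> \<beta> * (\<mu> x - 1 / 100)" using \<beta>pos large by simp
  ultimately have "(\<beta> * (\<mu> x - 1 / 100))\<^sup>2 \<le> (\<mu> x * \<beta> - e)\<^sup>2" by (rule power_mono)
  then have "\<beta> * (\<beta> * (\<mu> x - 1 / 100)\<^sup>2) \<le> \<beta> * (\<mu> x * z / d\<^sup>2)"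
    using CS by (simp add: power2_commute[of e] power_mult_distrib power2_eq_square[of \<beta>] mult.assoc)
  then have "\<beta> * (\<mu> x - 1 / 100)\<^sup>2 \<le> \<mu> x * z / d\<^sup>2" using \<beta>pos by (simp only: mult_le_cancel_left_pos)
  then have "d * (d * \<beta>) * (\<mu> x - 1 / 100)\<^sup>2 \<le> \<mu> x * z"
    using d by (simp add: field_simps power2_eq_square)
  moreover have "2 * z * (\<mu> x - 1 / 100)\<^sup>2 \<le> d * (d * \<beta>) * (\<mu> x - 1 / 100)\<^sup>2"
    using d \<beta>z zpos by (intro mult_right_mono mult_mono) auto
  ultimately have "z * (2 * (\<mu> x - 1 / 100)\<^sup>2) \<le> z * \<mu> x" by (simp add: mult_ac)
  then have "2 * (\<mu> x - 1 / 100)\<^sup>2 \<le> \<mu> x" using zpos by simp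
  moreover have "(\<mu> x - 63 / 100) * (\<mu> x - 1 / 100) \<ge> 0" using large by simp
  ultimately show False using large unfolding power2_eq_square left_diff_distrib right_diff_distrib by linarith
qed

lemma ex_element_of_nearly_full_degree:
  assumes "(real s)\<^sup>2 * \<tau> \<le> 1 / 10 ^ 6"
  shows "\<exists>x\<in>X. 1 - \<mu> x \<le> 100 * (real s)\<^sup>2 * \<tau>"
  using ex_large_degree[OF assms] large_degree_nearly_full by blast

end

section \<open>Size and degrees of the complementary family\<close>

lemma transversal_complement:
  assumes \<F>: "\<F> \<subseteq> nsets {1..s * k} k" and \<nu>: "matching_number \<F> \<le> s - 1" and sk: "1 \<le> s" "1 \<le> k"
    and \<sigma>: "\<sigma> permutes {1..s * k}"
  shows "\<exists>j<s. \<sigma> ` block k j \<in> nsets {1..s * k} k - \<F>"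
proof (rule ccontr)
  assume neg: "\<not> ?thesis"
  define M where "M = (\<lambda>j. \<sigma> ` block k j) ` {..<s}"
  have inj: "inj \<sigma>" using \<sigma> by (rule permutes_inj)
  have "\<sigma> ` block k j \<in> nsets {1..s * k} k" if "j < s" for j
  proof -
    have "\<sigma> ` block k j \<subseteq> \<sigma> ` {1..s * k}" using block_subset[OF that] by (rule image_mono)
    then have "\<sigma> ` block k j \<subseteq> {1..s * k}" unfolding permutes_image[OF \<sigma>] .
    moreover have "card (\<sigma> ` block k j) = k"
      using card_image[OF inj_on_subset[OF inj subset_UNIV]] by simp
    moreover have "finite (\<sigma> ` block k j)" by (simp add: block_def)
    ultimately show ?thesis unfolding nsets_def by blast
  qed
  then have MF: "M \<subseteq> \<F>" using neg unfolding M_def by blast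
  have disj: "\<sigma> ` block k i \<inter> \<sigma> ` block k j = {}" if "i \<noteq> j" for i j
  proof -
    have "block k i \<inter> block k j = {}"
      using that block_disjoint[of i j k] block_disjoint[of j i k] by (cases "i < j") auto
    then show ?thesis using image_Int[OF inj, of "block k i" "block k j"] by simp
  qed
  have "disjoint M"
    unfolding disjoint_def
  proof (intro ballI impI)
    fix A B assume "A \<in> M" "B \<in> M" "A \<noteq> B"
    then obtain i j where "A = \<sigma> ` block k i" "B = \<sigma> ` block k j" "i \<noteq> j" by (auto simp: M_def)
    then show "A \<inter> B = {}" using disj[of i j] by simp
  qed
  have "inj_on (\<lambda>j. \<sigma> ` block k j) {..<s}"
  proof (rule inj_onI, rule ccontr)
    fix i j assume eq: "\<sigma> ` block k i = \<sigma> ` block k j" and "i \<noteq> j"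
    have "\<sigma> ` block k i = {}" using disj[OF \<open>i \<noteq> j\<close>] unfolding eq by simp
    then have "block k i = {}" by blast
    then have "card (block k i) = 0" by (simp only: card.empty)
    then show False using sk by simp
  qed
  then have "card M = s" by (simp add: M_def card_image)
  have "finite \<F>" using finite_subset[OF \<F> finite_imp_finite_nsets] by simp
  then have "finite (card ` Pow \<F>)" by simp
  moreover have "{card M | M. M \<subseteq> \<F> \<and> disjoint M} \<subseteq> card ` Pow \<F>" by blast
  ultimately have "finite {card M | M. M \<subseteq> \<F> \<and> disjoint M}" by (rule rev_finite_subset)
  moreover have "s \<in> {card M | M. M \<subseteq> \<F> \<and> disjoint M}"
    using MF \<open>disjoint M\<close> \<open>card M = s\<close> by blast
  ultimately have "s \<le> matching_number \<F>" unfolding matching_number_def by (rule Max_ge)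
  then show False using \<nu> sk by linarith
qed

context matching_transversal
begin

lemma card_complement: "real (card (\<Omega> - G)) = (1 - \<alpha>) * real (card \<Omega>)"
proof -
  have G\<Omega>: "G \<subseteq> \<Omega>" using G by (simp add: \<Omega>_def X_def)
  have "(\<Sum>A\<in>\<Omega>. g A) = real (card G)"
    unfolding g_def using fin\<Omega>(1) Int_absorb1[OF G\<Omega>] by simp
  then have "\<alpha> * real (card \<Omega>) = real (card G)"
    unfolding \<alpha>_def avg_def using fin\<Omega> by simp
  moreover have "card G \<le> card \<Omega>" using fin\<Omega> G\<Omega> by (simp add: card_mono)
  ultimately show ?thesis
    using fin\<Omega> G\<Omega> finite_subset[OF G\<Omega>] by (simp add: card_Diff_subset of_nat_diff algebra_simps)
qed

lemma family_degree_complement: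
  assumes x: "x \<in> X"
  shows "real (family_degree (\<Omega> - G) x) = (1 - \<mu> x) * real ((s * k - 1) choose (k - 1))"
proof -
  obtain i where i: "k = Suc i" using k by (cases k) auto
  then have ki: "k - 1 = i" by simp
  let ?N = "nsets (X - {x}) i"
  have card: "card ?N = (s * k - 1) choose i" using x by (simp add: card_X)
  have nonempty: "finite ?N" "?N \<noteq> {}"
  proof -
    show "finite ?N" by (intro finite_imp_finite_nsets) simp
    have "i \<le> card (X - {x})" using bounds(2) i x by simp
    then show "?N \<noteq> {}" unfolding nsets_eq_empty_iff by simp
  qed
  have "real (family_degree (\<Omega> - G) x) = (\<Sum>A\<in>\<Omega>. if x \<in> A then 1 - g A else 0)"
  proof -
    have "(\<Sum>A\<in>\<Omega>. if x \<in> A then 1 - g A else 0) = (\<Sum>A\<in>\<Omega>. of_bool (A \<in> \<Omega> - G \<and> x \<in> A))"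
      by (intro sum.cong refl) (auto simp: g_def)
    also have "\<dots> = real (card {A \<in> \<Omega> - G. x \<in> A})"
    proof -
      have "\<Omega> \<inter> {A. A \<in> \<Omega> - G \<and> x \<in> A} = {A \<in> \<Omega> - G. x \<in> A}" by blast
      then show ?thesis by (simp only: sum_of_bool_eq fin\<Omega>(1))
    qed
    finally show ?thesis by (simp add: family_degree_def)
  qed
  also have "\<dots> = (\<Sum>S\<in>?N. 1 - g (insert x S))"
    unfolding \<Omega>_def
    using sum_nsets_containing[OF finite_X x, where j = i and f = "\<lambda>A. 1 - g A", folded i] .
  also have "\<dots> = avg ?N (\<lambda>S. 1 - g (insert x S)) * real (card ?N)"
    unfolding avg_def using nonempty by (simp del: card_nsets)
  also have "avg ?N (\<lambda>S. 1 - g (insert x S)) = 1 - \<mu> x"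
    unfolding \<mu>_def ki avg_diff by (simp only: avg_const[OF nonempty])
  finally show ?thesis unfolding card ki .
qed

text \<open>
For a surplus that is not tiny there is nothing to prove, because \<open>\<delta>\<close> is bounded; this is where the
constant \<open>10 ^ 6\<close> comes from.
\<close>

lemma excess_ge_min_degree:
  assumes \<delta>: "\<delta> \<le> 1" and deg: "\<And>x. x \<in> X \<Longrightarrow> \<delta> \<le> 1 - \<mu> x"
  shows "\<delta> / 10 ^ 6 \<le> (real s)\<^sup>2 * \<tau>"
proof (cases "(real s)\<^sup>2 * \<tau> \<le> 1 / 10 ^ 6")
  case True
  then obtain x where "x \<in> X" "1 - \<mu> x \<le> 100 * (real s)\<^sup>2 * \<tau>"
    using ex_element_of_nearly_full_degree by blast
  then have "\<delta> \<le> 100 * ((real s)\<^sup>2 * \<tau>)" using deg[of x] by simp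
  moreover have "(real s)\<^sup>2 * \<tau> \<ge> 0" using \<tau>_nonneg by simp
  ultimately show ?thesis by simp
next
  case False
  then show ?thesis using \<delta> by simp
qed

end

theorem theorem4:
  shows "\<exists>(C::real) > 0. \<exists>(\<delta>\<^sub>0::real) > 0.
    \<forall>(s::nat) (k::nat) (\<delta>::real) (\<F>::nat set set).
      s \<ge> 3 \<longrightarrow> k \<ge> 1 \<longrightarrow> \<delta> \<le> \<delta>\<^sub>0 \<longrightarrow>
      \<F> \<subseteq> nsets {1..s * k} k \<longrightarrow>
      matching_number \<F> \<le> s - 1 \<longrightarrow>
      real (min_degree {1..s * k} \<F>) \<ge> \<delta> * real ((s * k - 1) choose (k - 1)) \<longrightarrow>
      real (card \<F>) \<le>
        ((real s - 1) / real s - (real s - 2) * \<delta> / (real s ^ 3 * (real s - 1) * C))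
          * real ((s * k) choose k)"
proof (rule exI[of _ "10 ^ 6"], rule conjI, simp, rule exI[of _ 1], intro conjI allI impI)
  fix s k :: nat and \<delta> :: real and \<F> :: "nat set set"
  assume s: "3 \<le> s" and k: "1 \<le> k" and \<delta>: "\<delta> \<le> 1" and \<F>: "\<F> \<subseteq> nsets {1..s * k} k"
    and \<nu>: "matching_number \<F> \<le> s - 1"
    and deg: "\<delta> * real ((s * k - 1) choose (k - 1)) \<le> real (min_degree {1..s * k} \<F>)"
  interpret matching_transversal s k "nsets {1..s * k} k - \<F>"
    using s k transversal_complement[OF \<F> \<nu>] by unfold_locales auto
  have compl: "\<Omega> - (nsets {1..s * k} k - \<F>) = \<F>" using \<F> by (auto simp: \<Omega>_def X_def)
  have card: "real (card \<F>) = (1 - \<alpha>) * real ((s * k) choose k)"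
    using card_complement unfolding compl by (simp add: \<Omega>_def card_X)
  have "\<delta> \<le> 1 - \<mu> x" if x: "x \<in> X" for x
  proof -
    have "min_degree {1..s * k} \<F> \<le> family_degree \<F> x"
      unfolding min_degree_def using x by (intro Min_le) (auto simp: X_def)
    then have "\<delta> * real ((s * k - 1) choose (k - 1)) \<le> (1 - \<mu> x) * real ((s * k - 1) choose (k - 1))"
      using deg family_degree_complement[OF x] unfolding compl by linarith
    moreover have "real ((s * k - 1) choose (k - 1)) > 0"
      using bounds(2) by (simp add: card_X)
    ultimately show ?thesis by simp
  qed
  from excess_ge_min_degree[OF \<delta> this] have \<tau>: "\<delta> / 10 ^ 6 \<le> (real s)\<^sup>2 * \<tau>" by blast
  define q where "q = (real s - 2) / (real s - 1)"
  have q: "0 \<le> q" "q \<le> 1" using s by (simp_all add: q_def)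
  have "q * (\<delta> / 10 ^ 6) \<le> q * ((real s)\<^sup>2 * \<tau>)" using \<tau> q by (intro mult_left_mono) auto
  also have "\<dots> \<le> (real s)\<^sup>2 * \<tau>"
    using q \<tau>_nonneg by (intro mult_left_le_one_le) auto
  finally have "q * (\<delta> / 10 ^ 6) / real s ^ 3 \<le> (real s)\<^sup>2 * \<tau> / real s ^ 3"
    by (rule divide_right_mono) simp
  also have "\<dots> = \<tau> / real s" using s by (simp add: power2_eq_square power3_eq_cube)
  also have "\<dots> = \<alpha> - 1 / real s" unfolding \<tau>_def using s by (simp add: diff_divide_distrib)
  finally have le: "q * (\<delta> / 10 ^ 6) / real s ^ 3 \<le> \<alpha> - 1 / real s" .
  have "1 - \<alpha> \<le> (real s - 1) / real s - q * (\<delta> / 10 ^ 6) / real s ^ 3"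
  proof -
    have "(real s - 1) / real s = 1 - 1 / real s" using s by (simp add: diff_divide_distrib)
    then show ?thesis using le by linarith
  qed
  also have "q * (\<delta> / 10 ^ 6) / real s ^ 3 = (real s - 2) * \<delta> / (real s ^ 3 * (real s - 1) * 10 ^ 6)"
    by (simp add: q_def)
  finally show "real (card \<F>) \<le>
        ((real s - 1) / real s - (real s - 2) * \<delta> / (real s ^ 3 * (real s - 1) * 10 ^ 6))
          * real ((s * k) choose k)"
    unfolding card by (rule mult_right_mono) simp
qed simp_all

end
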